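(* Let $G$ be a countable discrete group with Kazhdan's property (T), and assume that the full group $C^*$-algebra $C^*(G)$ is primitive. Then $G$ is trivial.
   Context: A (separable) $C^*$-algebra is primitive if it has a faithful nonzero irreducible representation, where a representation is a $*$-homomorphism into the bounded operators on some complex Hilbert space. *)

theory Defs
  imports Complex_Main "HOL-Library.Countable_Set" "HOL-Library.Function_Algebras"
    "HOL-Algebra.Module"
begin

section \<open>Complex Hilbert spaces\<close>

text \<open>
  The vectors form a subspace of an ambient complex vector space whose addition is that of the
  type; the inner product is linear in the second argument and is only relevant on the subspace.
  Carriers are explicit because representations on closed subspaces, and
  quantification over all Hilbert spaces within a formula, are needed.
\<close>

record 'h hilbert =
  hspace :: "'h set"
  hscale :: "complex \<Rightarrow> 'h \<Rightarrow> 'h"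
  hinner :: "'h \<Rightarrow> 'h \<Rightarrow> complex"

definition hnorm :: "'h hilbert \<Rightarrow> 'h \<Rightarrow> real" where
  "hnorm H x = sqrt (Re (hinner H x x))"

locale complex_hilbert_space = vector_space "hscale H"
  for H :: "'h::ab_group_add hilbert" +
  assumes subspace_hspace: "subspace (hspace H)"
    and hinner_commute:
      "\<lbrakk>x \<in> hspace H; y \<in> hspace H\<rbrakk> \<Longrightarrow> hinner H y x = cnj (hinner H x y)"
    and hinner_add_right:
      "\<lbrakk>x \<in> hspace H; y \<in> hspace H; z \<in> hspace H\<rbrakk>
        \<Longrightarrow> hinner H x (y + z) = hinner H x y + hinner H x z"
    and hinner_scale_right:
      "\<lbrakk>x \<in> hspace H; y \<in> hspace H\<rbrakk> \<Longrightarrow> hinner H x (hscale H c y) = c * hinner H x y"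
    and hinner_pos:
      "\<lbrakk>x \<in> hspace H; x \<noteq> 0\<rbrakk> \<Longrightarrow> 0 < Re (hinner H x x)"
    and hspace_complete:
      "\<lbrakk>\<And>n. X n \<in> hspace H;
        \<forall>e>0. \<exists>N. \<forall>m\<ge>N. \<forall>n\<ge>N. hnorm H (X m - X n) < e\<rbrakk>
        \<Longrightarrow> \<exists>x\<in>hspace H. (\<lambda>n. hnorm H (X n - x)) \<longlonglongrightarrow> 0"

definition closed_hsubspace :: "'h::ab_group_add hilbert \<Rightarrow> 'h set \<Rightarrow> bool" where
  "closed_hsubspace H W \<longleftrightarrow>
     W \<subseteq> hspace H \<and> Modules.module.subspace (hscale H) W \<and>
     (\<forall>X. \<forall>x\<in>hspace H.
        (\<forall>n. X n \<in> W) \<and> (\<lambda>n. hnorm H (X n - x)) \<longlonglongrightarrow> 0 \<longrightarrow> x \<in> W)"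

text \<open>Operators are functions on the ambient type that are only inspected on \<^term>\<open>hspace H\<close>.\<close>

definition linear_operator :: "'h::ab_group_add hilbert \<Rightarrow> ('h \<Rightarrow> 'h) \<Rightarrow> bool" where
  "linear_operator H T \<longleftrightarrow>
     (\<forall>x\<in>hspace H. T x \<in> hspace H) \<and>
     (\<forall>x\<in>hspace H. \<forall>y\<in>hspace H. T (x + y) = T x + T y) \<and>
     (\<forall>c. \<forall>x\<in>hspace H. T (hscale H c x) = hscale H c (T x))"

definition bounded_operator :: "'h::ab_group_add hilbert \<Rightarrow> ('h \<Rightarrow> 'h) \<Rightarrow> bool" where
  "bounded_operator H T \<longleftrightarrow>
     linear_operator H T \<and> (\<exists>K. \<forall>x\<in>hspace H. hnorm H (T x) \<le> K * hnorm H x)"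

definition opnorm :: "'h hilbert \<Rightarrow> ('h \<Rightarrow> 'h) \<Rightarrow> real" where
  "opnorm H T = (SUP x \<in> {x \<in> hspace H. hnorm H x \<le> 1}. hnorm H (T x))"

definition unitary_operator :: "'h::ab_group_add hilbert \<Rightarrow> ('h \<Rightarrow> 'h) \<Rightarrow> bool" where
  "unitary_operator H U \<longleftrightarrow>
     linear_operator H U \<and> bij_betw U (hspace H) (hspace H) \<and>
     (\<forall>x\<in>hspace H. \<forall>y\<in>hspace H. hinner H (U x) (U y) = hinner H x y)"


section \<open>Unitary representations and property (T)\<close>

definition unitary_rep ::
  "('g, 'm) monoid_scheme \<Rightarrow> 'h::ab_group_add hilbert \<Rightarrow> ('g \<Rightarrow> 'h \<Rightarrow> 'h) \<Rightarrow> bool" where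
  "unitary_rep G H \<pi> \<longleftrightarrow>
     complex_hilbert_space H \<and>
     (\<forall>g\<in>carrier G. unitary_operator H (\<pi> g)) \<and>
     (\<forall>x\<in>hspace H. \<pi> \<one>\<^bsub>G\<^esub> x = x) \<and>
     (\<forall>g\<in>carrier G. \<forall>h\<in>carrier G. \<forall>x\<in>hspace H. \<pi> (g \<otimes>\<^bsub>G\<^esub> h) x = \<pi> g (\<pi> h x))"

text \<open>
  Higher-order logic cannot quantify over types inside a formula, so ``all unitary representations''
  of a discrete group with elements in \<^typ>\<open>'g\<close> is rendered as all those on Hilbert spaces with
  vectors in \<^typ>\<open>'g \<Rightarrow> complex\<close>. Up to unitary equivalence this includes every cyclic
  representation: if \<open>v\<close> is a cyclic vector of \<open>\<pi>\<close>, then \<open>w \<mapsto> (\<lambda>g. \<langle>\<pi> g v, w\<rangle>)\<close> (extended by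
  0 off the group) is linear and injective, and the Hilbert space structure can be transported
  along it. Cyclic representations determine both notions below: an almost invariant vector
  generates a cyclic subrepresentation, in which an invariant vector is to be found, and
  \<open>\<parallel>\<pi>(f) x\<parallel>\<close> only depends on the cyclic subrepresentation generated by \<open>x\<close>.
\<close>

text \<open>For a discrete group the compact sets in the definition of property (T) are the finite ones.\<close>

definition kazhdan_property_T :: "('g, 'm) monoid_scheme \<Rightarrow> bool" where
  "kazhdan_property_T G \<longleftrightarrow>
     (\<exists>S \<epsilon>. finite S \<and> S \<subseteq> carrier G \<and> \<epsilon> > 0 \<and>
        (\<forall>(H :: ('g \<Rightarrow> complex) hilbert) \<pi>.
           unitary_rep G H \<pi> \<and>
           (\<exists>x\<in>hspace H. x \<noteq> 0 \<and> (\<forall>s\<in>S. hnorm H (\<pi> s x - x) < \<epsilon> * hnorm H x)) \<longrightarrow>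
           (\<exists>y\<in>hspace H. y \<noteq> 0 \<and> (\<forall>g\<in>carrier G. \<pi> g y = y))))"


section \<open>Normed *-algebras and their completions\<close>

record 'a star_algebra = "(complex, 'a) module" +
  invol :: "'a \<Rightarrow> 'a"
  anorm :: "'a \<Rightarrow> real"

definition adist :: "('a, 'm) star_algebra_scheme \<Rightarrow> 'a \<Rightarrow> 'a \<Rightarrow> real" where
  "adist A x y = anorm A (x \<oplus>\<^bsub>A\<^esub> ((-1) \<odot>\<^bsub>A\<^esub> y))"

definition cauchy_seqs :: "('a, 'm) star_algebra_scheme \<Rightarrow> (nat \<Rightarrow> 'a) set" where
  "cauchy_seqs A = {X. (\<forall>n. X n \<in> carrier A) \<and>
     (\<forall>e>0. \<exists>N. \<forall>m\<ge>N. \<forall>n\<ge>N. adist A (X m) (X n) < e)}"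

definition cauchy_rel :: "('a, 'm) star_algebra_scheme \<Rightarrow> ((nat \<Rightarrow> 'a) \<times> (nat \<Rightarrow> 'a)) set" where
  "cauchy_rel A = {(X, Y). X \<in> cauchy_seqs A \<and> Y \<in> cauchy_seqs A \<and>
     (\<lambda>n. adist A (X n) (Y n)) \<longlonglongrightarrow> 0}"

definition cauchy_class :: "('a, 'm) star_algebra_scheme \<Rightarrow> (nat \<Rightarrow> 'a) \<Rightarrow> (nat \<Rightarrow> 'a) set" where
  "cauchy_class A X = cauchy_rel A `` {X}"

definition class_rep :: "(nat \<Rightarrow> 'a) set \<Rightarrow> nat \<Rightarrow> 'a" where
  "class_rep P = (SOME X. X \<in> P)"

definition completion :: "('a, 'm) star_algebra_scheme \<Rightarrow> (nat \<Rightarrow> 'a) set star_algebra" where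
  "completion A =
    \<lparr>carrier = cauchy_seqs A // cauchy_rel A,
     mult = (\<lambda>P Q. cauchy_class A (\<lambda>n. class_rep P n \<otimes>\<^bsub>A\<^esub> class_rep Q n)),
     one = cauchy_class A (\<lambda>n. \<one>\<^bsub>A\<^esub>),
     zero = cauchy_class A (\<lambda>n. \<zero>\<^bsub>A\<^esub>),
     add = (\<lambda>P Q. cauchy_class A (\<lambda>n. class_rep P n \<oplus>\<^bsub>A\<^esub> class_rep Q n)),
     smult = (\<lambda>c P. cauchy_class A (\<lambda>n. c \<odot>\<^bsub>A\<^esub> class_rep P n)),
     invol = (\<lambda>P. cauchy_class A (\<lambda>n. invol A (class_rep P n))),
     anorm = (\<lambda>P. lim (\<lambda>n. anorm A (class_rep P n)))\<rparr>"


section \<open>The full group C*-algebra\<close>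

text \<open>
  The operator \<open>\<pi>(f) = \<Sum>\<^sub>g f(g) \<pi>(g)\<close> for a finitely supported function \<open>f\<close> on the group.
\<close>

definition integrated_rep ::
  "'h::ab_group_add hilbert \<Rightarrow> ('g \<Rightarrow> 'h \<Rightarrow> 'h) \<Rightarrow> ('g \<Rightarrow> complex) \<Rightarrow> 'h \<Rightarrow> 'h" where
  "integrated_rep H \<pi> f x = (\<Sum>g | f g \<noteq> 0. hscale H (f g) (\<pi> g x))"

text \<open>
  The supremum is over a nonempty set bounded by \<open>\<Sum>\<^sub>g |f(g)|\<close>.
\<close>

definition full_norm :: "('g, 'm) monoid_scheme \<Rightarrow> ('g \<Rightarrow> complex) \<Rightarrow> real" where
  "full_norm G f = Sup {opnorm H (integrated_rep H \<pi> f) | (H :: ('g \<Rightarrow> complex) hilbert) \<pi>.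
     unitary_rep G H \<pi>}"

definition group_star_algebra :: "('g, 'm) monoid_scheme \<Rightarrow> ('g \<Rightarrow> complex) star_algebra" where
  "group_star_algebra G =
    \<lparr>carrier = {f. finite {g. f g \<noteq> 0} \<and> {g. f g \<noteq> 0} \<subseteq> carrier G},
     mult = (\<lambda>f h x. if x \<in> carrier G
                     then \<Sum>y | f y \<noteq> 0. f y * h (inv\<^bsub>G\<^esub> y \<otimes>\<^bsub>G\<^esub> x) else 0),
     one = (\<lambda>x. if x = \<one>\<^bsub>G\<^esub> then 1 else 0),
     zero = (\<lambda>x. 0),
     add = (\<lambda>f h x. f x + h x),
     smult = (\<lambda>c f x. c * f x),
     invol = (\<lambda>f x. if x \<in> carrier G then cnj (f (inv\<^bsub>G\<^esub> x)) else 0),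
     anorm = full_norm G\<rparr>"

definition full_group_cstar_algebra ::
  "('g, 'm) monoid_scheme \<Rightarrow> (nat \<Rightarrow> 'g \<Rightarrow> complex) set star_algebra" where
  "full_group_cstar_algebra G = completion (group_star_algebra G)"


section \<open>Representations of C*-algebras and primitivity\<close>

text \<open>
  The last clause says that \<open>\<phi> (a\<^sup>*)\<close> is the adjoint of \<open>\<phi> a\<close>.
\<close>

definition star_rep ::
  "('a, 'm) star_algebra_scheme \<Rightarrow> 'h::ab_group_add hilbert \<Rightarrow> ('a \<Rightarrow> 'h \<Rightarrow> 'h) \<Rightarrow> bool" where
  "star_rep A H \<phi> \<longleftrightarrow>
     complex_hilbert_space H \<and>
     (\<forall>a\<in>carrier A. bounded_operator H (\<phi> a)) \<and>
     (\<forall>a\<in>carrier A. \<forall>b\<in>carrier A. \<forall>x\<in>hspace H. \<phi> (a \<oplus>\<^bsub>A\<^esub> b) x = \<phi> a x + \<phi> b x) \<and>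
     (\<forall>c. \<forall>a\<in>carrier A. \<forall>x\<in>hspace H. \<phi> (c \<odot>\<^bsub>A\<^esub> a) x = hscale H c (\<phi> a x)) \<and>
     (\<forall>a\<in>carrier A. \<forall>b\<in>carrier A. \<forall>x\<in>hspace H. \<phi> (a \<otimes>\<^bsub>A\<^esub> b) x = \<phi> a (\<phi> b x)) \<and>
     (\<forall>a\<in>carrier A. \<forall>x\<in>hspace H. \<forall>y\<in>hspace H.
        hinner H (\<phi> (invol A a) x) y = hinner H x (\<phi> a y))"

definition nonzero_rep ::
  "('a, 'm) star_algebra_scheme \<Rightarrow> 'h::ab_group_add hilbert \<Rightarrow> ('a \<Rightarrow> 'h \<Rightarrow> 'h) \<Rightarrow> bool" where
  "nonzero_rep A H \<phi> \<longleftrightarrow> (\<exists>a\<in>carrier A. \<exists>x\<in>hspace H. \<phi> a x \<noteq> 0)"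

definition faithful_rep ::
  "('a, 'm) star_algebra_scheme \<Rightarrow> 'h hilbert \<Rightarrow> ('a \<Rightarrow> 'h \<Rightarrow> 'h) \<Rightarrow> bool" where
  "faithful_rep A H \<phi> \<longleftrightarrow>
     (\<forall>a\<in>carrier A. \<forall>b\<in>carrier A. (\<forall>x\<in>hspace H. \<phi> a x = \<phi> b x) \<longrightarrow> a = b)"

definition irreducible_rep ::
  "('a, 'm) star_algebra_scheme \<Rightarrow> 'h::ab_group_add hilbert \<Rightarrow> ('a \<Rightarrow> 'h \<Rightarrow> 'h) \<Rightarrow> bool" where
  "irreducible_rep A H \<phi> \<longleftrightarrow>
     (\<forall>W. closed_hsubspace H W \<and> (\<forall>a\<in>carrier A. \<forall>w\<in>W. \<phi> a w \<in> W) \<longrightarrow>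
        W = {0} \<or> W = hspace H)"

text \<open>
  The type argument is where the vectors of the representation live. A theorem that assumes
  primitivity with a type variable here covers representations on arbitrary Hilbert spaces.
\<close>

definition primitive ::
  "'h::ab_group_add itself \<Rightarrow> ('a, 'm) star_algebra_scheme \<Rightarrow> bool" where
  "primitive _ A \<longleftrightarrow>
     (\<exists>(H :: 'h hilbert) \<phi>. star_rep A H \<phi> \<and> nonzero_rep A H \<phi> \<and>
        irreducible_rep A H \<phi> \<and> faithful_rep A H \<phi>)"

end

theory Submission
  imports Defs "HOL-Analysis.Infinite_Sum"
begin

text \<open>
  Let \<open>f\<close> be the uniform probability measure on a finite Kazhdan set containing the unit. In every
  unitary representation the operator \<open>f\<close> contracts the orthogonal complement of the invariant
  vectors by a uniform factor \<open>r < 1\<close>, and this complement contains the range of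
  \<open>h - \<epsilon>(h)\<close> for all \<open>h\<close> in the group algebra, where \<open>\<epsilon>\<close> is the
  augmentation. Hence \<open>\<parallel>f\<^sup>n h - \<epsilon>(h) f\<^sup>n\<parallel> \<le> 2 r\<^sup>n \<parallel>h\<parallel>\<close>, so the powers \<open>f\<^sup>n\<close>
  converge in \<open>C\<^sup>*(G)\<close> to the Kazhdan projection \<open>p \<noteq> 0\<close>, and \<open>p a = \<epsilon>(a) p\<close> for all \<open>a\<close>. If \<open>\<phi>\<close>
  is irreducible and faithful, the kernel of \<open>\<phi>(p)\<close> is a proper closed invariant subspace, hence
  zero. Since \<open>\<phi>(p)\<close> annihilates the range of \<open>\<phi>(a) - \<epsilon>(a)\<close>, it follows that
  \<open>\<phi>(a) = \<epsilon>(a)\<close>, so all group elements coincide in \<open>C\<^sup>*(G)\<close>; the regular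
  representation tells them apart.
\<close>

section \<open>Hilbert spaces\<close>

definition orth_complement :: "'h hilbert \<Rightarrow> 'h set \<Rightarrow> 'h set" where
  "orth_complement H W = {x \<in> hspace H. \<forall>u\<in>W. hinner H u x = 0}"

section \<open>Inner product calculus on the carrier of a Hilbert space\<close>

context complex_hilbert_space
begin

lemma zero_hspace [simp]: "0 \<in> hspace H"
  using subspace_hspace by (rule subspace_0)

lemma add_hspace: "x \<in> hspace H \<Longrightarrow> y \<in> hspace H \<Longrightarrow> x + y \<in> hspace H"
  using subspace_hspace by (rule subspace_add)

lemma diff_hspace: "x \<in> hspace H \<Longrightarrow> y \<in> hspace H \<Longrightarrow> x - y \<in> hspace H"
  using subspace_hspace by (rule subspace_diff)

lemma scale_hspace: "x \<in> hspace H \<Longrightarrow> hscale H c x \<in> hspace H"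
  using subspace_hspace by (rule subspace_scale)

lemma sum_hspace: "(\<And>i. i \<in> I \<Longrightarrow> f i \<in> hspace H) \<Longrightarrow> sum f I \<in> hspace H"
  using subspace_hspace by (rule subspace_sum)

lemmas hspace_intros = add_hspace diff_hspace scale_hspace sum_hspace

lemma hinner_add_left:
  assumes "x \<in> hspace H" "y \<in> hspace H" "z \<in> hspace H"
  shows "hinner H (x + y) z = hinner H x z + hinner H y z"
  using assms hinner_commute[of z "x + y"] hinner_commute[of z x] hinner_commute[of z y]
  by (simp add: hinner_add_right add_hspace)

lemma hinner_scale_left:
  assumes "x \<in> hspace H" "y \<in> hspace H"
  shows "hinner H (hscale H c x) y = cnj c * hinner H x y"
  using assms hinner_commute[of y "hscale H c x"] hinner_commute[of y x]
  by (simp add: hinner_scale_right scale_hspace)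

lemma hinner_diff_right:
  assumes "x \<in> hspace H" "y \<in> hspace H" "z \<in> hspace H"
  shows "hinner H x (y - z) = hinner H x y - hinner H x z"
  using hinner_add_right[of x "y - z" z] assms by (simp add: diff_hspace)

lemma hinner_diff_left:
  assumes "x \<in> hspace H" "y \<in> hspace H" "z \<in> hspace H"
  shows "hinner H (x - y) z = hinner H x z - hinner H y z"
  using hinner_add_left[of "x - y" y z] assms by (simp add: diff_hspace)

lemma hinner_zero_right: "x \<in> hspace H \<Longrightarrow> hinner H x 0 = 0"
  using hinner_add_right[of x 0 0] by simp

lemma hinner_zero_left: "x \<in> hspace H \<Longrightarrow> hinner H 0 x = 0"
  using hinner_add_left[of 0 0 x] by simp

lemma hinner_self_nonneg: "x \<in> hspace H \<Longrightarrow> 0 \<le> Re (hinner H x x)"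
  using hinner_pos[of x] hinner_zero_right[of 0] by (cases "x = 0") auto

lemma hinner_self: "x \<in> hspace H \<Longrightarrow> hinner H x x = complex_of_real ((hnorm H x)\<^sup>2)"
  using hinner_commute[of x x] hinner_self_nonneg[of x]
  by (simp add: hnorm_def complex_eq_iff)

lemma hnorm_nonneg: "x \<in> hspace H \<Longrightarrow> 0 \<le> hnorm H x"
  by (simp add: hnorm_def hinner_self_nonneg)

lemma hnorm_zero [simp]: "hnorm H 0 = 0"
  by (simp add: hnorm_def hinner_zero_right)

lemma hnorm_pos: "x \<in> hspace H \<Longrightarrow> x \<noteq> 0 \<Longrightarrow> 0 < hnorm H x"
  using hinner_pos[of x] by (simp add: hnorm_def)

lemma hnorm_scale: "x \<in> hspace H \<Longrightarrow> hnorm H (hscale H c x) = cmod c * hnorm H x"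
proof -
  assume x: "x \<in> hspace H"
  have "hinner H (hscale H c x) (hscale H c x) = cnj c * c * complex_of_real ((hnorm H x)\<^sup>2)"
    using x by (simp add: scale_hspace hinner_scale_left hinner_scale_right hinner_self[OF x])
  also have "\<dots> = complex_of_real ((cmod c * hnorm H x)\<^sup>2)"
    using complex_norm_square[of c] by (simp add: power_mult_distrib mult.commute)
  finally have "Re (hinner H (hscale H c x) (hscale H c x)) = (cmod c * hnorm H x)\<^sup>2"
    by (metis Re_complex_of_real)
  then show ?thesis
    using x by (simp add: hnorm_def[of H "hscale H c x"] hnorm_nonneg)
qed

lemma hnorm_add_sq:
  assumes "x \<in> hspace H" "y \<in> hspace H"
  shows "(hnorm H (x + y))\<^sup>2 = (hnorm H x)\<^sup>2 + (hnorm H y)\<^sup>2 + 2 * Re (hinner H x y)"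
proof -
  have "hinner H (x + y) (x + y) =
      hinner H x x + hinner H y y + (hinner H x y + cnj (hinner H x y))"
    using assms hinner_commute[of x y]
    by (simp add: add_hspace hinner_add_left hinner_add_right)
  then have "Re (hinner H (x + y) (x + y)) =
      Re (hinner H x x) + Re (hinner H y y) + 2 * Re (hinner H x y)"
    by simp
  then show ?thesis
    using assms by (simp add: hinner_self add_hspace)
qed

lemma hnorm_diff_sq:
  assumes "x \<in> hspace H" "y \<in> hspace H"
  shows "(hnorm H (x - y))\<^sup>2 = (hnorm H x)\<^sup>2 + (hnorm H y)\<^sup>2 - 2 * Re (hinner H x y)"
  using assms hnorm_add_sq[of "x - y" y]
  by (simp add: diff_hspace hinner_diff_left hinner_self)

lemma cauchy_schwarz:
  assumes x: "x \<in> hspace H" and y: "y \<in> hspace H"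
  shows "cmod (hinner H x y) \<le> hnorm H x * hnorm H y"
proof (cases "x = 0")
  case True
  then show ?thesis using y by (simp add: hinner_zero_left)
next
  case False
  define a where "a = (hnorm H x)\<^sup>2"
  define c where "c = hinner H x y"
  have a: "a > 0" using hnorm_pos[OF x False] by (simp add: a_def)
  have xx: "hinner H x x = complex_of_real a" and yx: "hinner H y x = cnj c"
    using x y hinner_self[OF x] hinner_commute[OF x y] by (auto simp: a_def c_def)
  \<comment> \<open>\<open>?z\<close> is the squared norm of \<open>x\<close> times the component of
    \<open>y\<close> orthogonal to \<open>x\<close>; the multiplied form needs no division.\<close>
  let ?z = "hscale H a y - hscale H c x"
  have "hinner H ?z ?z = complex_of_real a * (complex_of_real a * hinner H y y - cnj c * c)"
    using x y xx yx
    by (simp add: hinner_diff_left hinner_diff_right scale_hspace diff_hspace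
        hinner_scale_left hinner_scale_right c_def[symmetric] algebra_simps)
  also have "\<dots> = complex_of_real (a * (a * (hnorm H y)\<^sup>2 - (cmod c)\<^sup>2))"
    using complex_norm_square[of c] by (simp add: hinner_self y mult.commute)
  finally have "0 \<le> a * (a * (hnorm H y)\<^sup>2 - (cmod c)\<^sup>2)"
    using hinner_self_nonneg[of ?z] x y by (simp add: scale_hspace diff_hspace)
  then have "(cmod c)\<^sup>2 \<le> (hnorm H x * hnorm H y)\<^sup>2"
    using a by (simp add: zero_le_mult_iff a_def power_mult_distrib)
  then show ?thesis
    unfolding c_def by (rule power2_le_imp_le) (simp add: hnorm_nonneg x y)
qed

lemma hnorm_triangle:
  assumes "x \<in> hspace H" "y \<in> hspace H"
  shows "hnorm H (x + y) \<le> hnorm H x + hnorm H y"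
proof (rule power2_le_imp_le)
  have "Re (hinner H x y) \<le> hnorm H x * hnorm H y"
    using cauchy_schwarz[OF assms] complex_Re_le_cmod order_trans by blast
  then show "(hnorm H (x + y))\<^sup>2 \<le> (hnorm H x + hnorm H y)\<^sup>2"
    using assms by (simp add: hnorm_add_sq power2_sum)
qed (use assms in \<open>simp add: hnorm_nonneg\<close>)

lemma hnorm_uminus: "x \<in> hspace H \<Longrightarrow> hnorm H (- x) = hnorm H x"
  using hnorm_scale[of x "-1"] by simp

lemma hnorm_diff_triangle:
  assumes "x \<in> hspace H" "y \<in> hspace H"
  shows "hnorm H (x - y) \<le> hnorm H x + hnorm H y"
  using hnorm_triangle[of x "- y"] assms hnorm_uminus[of y] scale_hspace[of y "-1"] by simp

lemma hnorm_sum: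
  assumes "finite I" "\<And>i. i \<in> I \<Longrightarrow> f i \<in> hspace H"
  shows "hnorm H (sum f I) \<le> (\<Sum>i\<in>I. hnorm H (f i))"
  using assms
proof (induction I rule: finite_induct)
  case (insert i I)
  then show ?case
    using hnorm_triangle[of "f i" "sum f I"] by (fastforce simp: sum_hspace)
qed simp

section \<open>Orthogonal complements as Hilbert spaces\<close>

lemma subspace_orth_complement:
  assumes W: "W \<subseteq> hspace H"
  shows "subspace (orth_complement H W)"
  using W by (auto intro!: subspaceI simp: orth_complement_def hinner_zero_right
      hinner_add_right hinner_scale_right hspace_intros subset_eq)

text \<open>Only completeness takes work, and it holds because the complement is closed: by
  Cauchy-Schwarz the inner product with a fixed vector is continuous. Shrinking
  \<open>hspace\<close> while keeping the operations leaves the type of vectors unchanged, so that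
  property (T) can be applied to the complement.\<close>

lemma orth_complement_hilbert:
  assumes W: "W \<subseteq> hspace H"
  shows "complex_hilbert_space (H\<lparr>hspace := orth_complement H W\<rparr>)"
proof -
  let ?V = "orth_complement H W"
  have sub: "subspace ?V"
    using W by (rule subspace_orth_complement)
  interpret K: vector_space "hscale (H\<lparr>hspace := ?V\<rparr>)"
    by (simp add: vector_space_axioms)
  have hn: "hnorm (H\<lparr>hspace := ?V\<rparr>) = hnorm H"
    by (simp add: hnorm_def fun_eq_iff)
  have VH: "x \<in> hspace H" if "x \<in> ?V" for x
    using that by (simp add: orth_complement_def)
  show ?thesis
  proof (unfold_locales, goal_cases)
    case 1
    then show ?case using sub by simp
  next
    case (2 x y)
    then show ?case using hinner_commute[OF VH VH, of x y] by simp
  next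
    case (3 x y z)
    then show ?case using hinner_add_right[OF VH VH VH, of x y z] by simp
  next
    case (4 x y c)
    then show ?case using hinner_scale_right[OF VH VH, of x y c] by simp
  next
    case (5 x)
    then show ?case using hinner_pos[OF VH, of x] by simp
  next
    case (6 X)
    then have XV: "X n \<in> ?V" for n by simp
    obtain x where x: "x \<in> hspace H" and lim: "(\<lambda>n. hnorm H (X n - x)) \<longlonglongrightarrow> 0"
      using hspace_complete[of X] VH[OF XV] 6(2) unfolding hn by blast
    have "hinner H u x = 0" if u: "u \<in> W" for u
    proof -
      have uH: "u \<in> hspace H" using u W by auto
      have "cmod (hinner H u x) \<le> hnorm H u * hnorm H (X n - x)" for n
      proof -
        have "hinner H u (X n - x) = - hinner H u x"
          using XV[of n] u uH x by (simp add: hinner_diff_right VH) (simp add: orth_complement_def)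
        then show ?thesis
          using cauchy_schwarz[OF uH, of "X n - x"] VH[OF XV[of n]] x by (simp add: diff_hspace)
      qed
      moreover have "(\<lambda>n. hnorm H u * hnorm H (X n - x)) \<longlonglongrightarrow> 0"
        using tendsto_mult_left[OF lim, of "hnorm H u"] by simp
      ultimately have "cmod (hinner H u x) \<le> 0"
        by (intro LIMSEQ_le_const) auto
      then show ?thesis by simp
    qed
    then show ?case
      using x lim unfolding hn by (auto simp: orth_complement_def)
  qed
qed

end


section \<open>Square-summable functions and the regular representation\<close>

text \<open>The vectors vanish off \<open>I\<close>, which makes the inner product definite on total
  functions. The index set is \<open>carrier G\<close> for the regular representation and a
  singleton for a one-dimensional space; both have the vector type over which
  \<open>full_norm\<close> takes its supremum.\<close>

definition l2_space :: "'g set \<Rightarrow> ('g \<Rightarrow> complex) hilbert" where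
  "l2_space I =
    \<lparr>hspace = {f. (\<forall>x. x \<notin> I \<longrightarrow> f x = 0) \<and> (\<lambda>x. (cmod (f x))\<^sup>2) summable_on I},
     hscale = (\<lambda>c f x. c * f x),
     hinner = (\<lambda>f h. \<Sum>\<^sub>\<infinity>x\<in>I. cnj (f x) * h x)\<rparr>"

lemma l2_space_simps:
  "hscale (l2_space I) = (\<lambda>c f x. c * f x)"
  "hinner (l2_space I) = (\<lambda>f h. \<Sum>\<^sub>\<infinity>x\<in>I. cnj (f x) * h x)"
  "f \<in> hspace (l2_space I) \<longleftrightarrow>
     (\<forall>x. x \<notin> I \<longrightarrow> f x = 0) \<and> (\<lambda>x. (cmod (f x))\<^sup>2) summable_on I"
  by (auto simp: l2_space_def)

lemma l2_summable_product:
  assumes "(\<lambda>x. (cmod (f x))\<^sup>2) summable_on I" "(\<lambda>x. (cmod (h x))\<^sup>2) summable_on I"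
  shows "(\<lambda>x. cnj (f x) * h x) summable_on I"
proof (rule abs_summable_summable, rule abs_summable_on_comparison_test')
  show "(\<lambda>x. (cmod (f x))\<^sup>2 + (cmod (h x))\<^sup>2) summable_on I"
    using assms by (rule summable_on_add)
  show "norm (cnj (f x) * h x) \<le> (cmod (f x))\<^sup>2 + (cmod (h x))\<^sup>2" for x
  proof -
    have "0 \<le> cmod (f x) * cmod (h x)" by simp
    then show ?thesis
      using sum_squares_bound[of "cmod (f x)" "cmod (h x)"]
      unfolding norm_mult complex_mod_cnj by linarith
  qed
qed

lemma hnorm_l2_space:
  assumes "(\<lambda>x. (cmod (f x))\<^sup>2) summable_on I"
  shows "hnorm (l2_space I) f = sqrt (\<Sum>\<^sub>\<infinity>x\<in>I. (cmod (f x))\<^sup>2)"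
proof -
  have "Re (\<Sum>\<^sub>\<infinity>x\<in>I. cnj (f x) * f x) = (\<Sum>\<^sub>\<infinity>x\<in>I. Re (cnj (f x) * f x))"
    using assms by (intro infsum_Re[symmetric] l2_summable_product)
  also have "\<dots> = (\<Sum>\<^sub>\<infinity>x\<in>I. (cmod (f x))\<^sup>2)"
    by (rule infsum_cong) (simp add: cmod_power2 power2_eq_square[of "Re _"] power2_eq_square[of "Im _"])
  finally show ?thesis
    by (simp add: hnorm_def l2_space_simps)
qed

lemma hnorm_l2_nonneg: "f \<in> hspace (l2_space I) \<Longrightarrow> 0 \<le> hnorm (l2_space I) f"
  by (simp add: hnorm_l2_space l2_space_simps infsum_nonneg)

text \<open>Membership and norm are controlled by finite partial sums alone. Finite sums commute
  with pointwise limits, which is what the completeness proof exploits.\<close>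

lemma l2_space_memI:
  assumes f: "\<And>F. finite F \<Longrightarrow> F \<subseteq> I \<Longrightarrow> (\<Sum>x\<in>F. (cmod (f x))\<^sup>2) \<le> C\<^sup>2"
    and supp: "\<And>x. x \<notin> I \<Longrightarrow> f x = 0" and C: "C \<ge> 0"
  shows "f \<in> hspace (l2_space I)" "hnorm (l2_space I) f \<le> C"
proof -
  have s: "(\<lambda>x. (cmod (f x))\<^sup>2) summable_on I"
    by (rule nonneg_bdd_above_summable_on) (use f in \<open>auto intro!: bdd_aboveI[where M="C\<^sup>2"]\<close>)
  then show "f \<in> hspace (l2_space I)"
    using supp by (simp add: l2_space_simps)
  have "sqrt (\<Sum>\<^sub>\<infinity>x\<in>I. (cmod (f x))\<^sup>2) \<le> sqrt (C\<^sup>2)"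
    using infsum_le_finite_sums[OF s f] by (intro real_sqrt_le_mono)
  then show "hnorm (l2_space I) f \<le> C" using C by (simp add: hnorm_l2_space[OF s])
qed

lemma l2_finite_sum_le:
  assumes f: "f \<in> hspace (l2_space I)" and F: "finite F" "F \<subseteq> I"
  shows "(\<Sum>x\<in>F. (cmod (f x))\<^sup>2) \<le> (hnorm (l2_space I) f)\<^sup>2"
proof -
  have s: "(\<lambda>x. (cmod (f x))\<^sup>2) summable_on I"
    using f by (simp add: l2_space_simps)
  have "(\<Sum>x\<in>F. (cmod (f x))\<^sup>2) \<le> (\<Sum>\<^sub>\<infinity>x\<in>I. (cmod (f x))\<^sup>2)"
    by (rule finite_sum_le_infsum[OF s F]) simp
  also have "\<dots> = (hnorm (l2_space I) f)\<^sup>2"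
    unfolding hnorm_l2_space[OF s] by (simp add: infsum_nonneg)
  finally show ?thesis .
qed

lemma vector_space_fun_scale: "vector_space (\<lambda>c (f :: 'g \<Rightarrow> complex) x. c * f x)"
  by unfold_locales (auto simp: fun_eq_iff algebra_simps)

lemma subspace_l2_space: "module.subspace (\<lambda>c (f :: 'g \<Rightarrow> complex) x. c * f x) (hspace (l2_space I))"
proof -
  interpret vector_space "\<lambda>c (f :: 'g \<Rightarrow> complex) x. c * f x"
    by (rule vector_space_fun_scale)
  show ?thesis
  proof (rule subspaceI)
    fix f h :: "'g \<Rightarrow> complex" and c
    assume f: "f \<in> hspace (l2_space I)"
    then show "(\<lambda>x. c * f x) \<in> hspace (l2_space I)"
      by (auto simp: l2_space_simps norm_mult power_mult_distrib intro: summable_on_cmult_right)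
    assume h: "h \<in> hspace (l2_space I)"
    have "(\<lambda>x. (cmod (f x + h x))\<^sup>2) summable_on I"
    proof (rule summable_on_comparison_test)
      show "(\<lambda>x. 2 * (cmod (f x))\<^sup>2 + 2 * (cmod (h x))\<^sup>2) summable_on I"
        using f h by (intro summable_on_add summable_on_cmult_right) (auto simp: l2_space_simps)
      show "(cmod (f x + h x))\<^sup>2 \<le> 2 * (cmod (f x))\<^sup>2 + 2 * (cmod (h x))\<^sup>2" for x
      proof -
        have "(cmod (f x + h x))\<^sup>2 \<le> (cmod (f x) + cmod (h x))\<^sup>2"
          by (intro power_mono norm_triangle_ineq) simp
        then show ?thesis
          using sum_squares_bound[of "cmod (f x)" "cmod (h x)"] unfolding power2_sum by linarith
      qed
    qed simp
    then show "f + h \<in> hspace (l2_space I)"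
      using f h by (simp add: l2_space_simps)
  qed (simp add: l2_space_simps)
qed

text \<open>A Cauchy sequence converges in every coordinate; the Cauchy bounds survive on each
  finite set of coordinates and hence for the whole norm.\<close>

lemma l2_space_complete:
  fixes X :: "nat \<Rightarrow> 'g \<Rightarrow> complex"
  assumes X: "\<And>n. X n \<in> hspace (l2_space I)"
    and cauchy: "\<forall>e>0. \<exists>N. \<forall>m\<ge>N. \<forall>n\<ge>N. hnorm (l2_space I) (X m - X n) < e"
  shows "\<exists>f\<in>hspace (l2_space I). (\<lambda>n. hnorm (l2_space I) (X n - f)) \<longlonglongrightarrow> 0"
proof -
  interpret vector_space "\<lambda>c (f :: 'g \<Rightarrow> complex) x. c * f x"
    by (rule vector_space_fun_scale)
  note diff = subspace_diff[OF subspace_l2_space]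
  have coord: "cmod (X m x - X n x) \<le> hnorm (l2_space I) (X m - X n)" if "x \<in> I" for m n x
  proof (rule power2_le_imp_le)
    show "(cmod (X m x - X n x))\<^sup>2 \<le> (hnorm (l2_space I) (X m - X n))\<^sup>2"
      using l2_finite_sum_le[OF diff[OF X[of m] X[of n]], of "{x}"] that by simp
    show "0 \<le> hnorm (l2_space I) (X m - X n)"
      by (intro hnorm_l2_nonneg diff X)
  qed
  have "\<exists>l. (\<lambda>n. X n x) \<longlonglongrightarrow> l" if "x \<in> I" for x
  proof -
    have "Cauchy (\<lambda>n. X n x)"
      using cauchy coord[OF that] unfolding Cauchy_def dist_norm by (meson le_less_trans)
    then show ?thesis
      by (simp add: Cauchy_convergent_iff convergent_def)
  qed
  then obtain l where l: "\<And>x. x \<in> I \<Longrightarrow> (\<lambda>n. X n x) \<longlonglongrightarrow> l x"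
    by metis
  define f where "f = (\<lambda>x. if x \<in> I then l x else 0)"
  have near: "\<exists>N. \<forall>n\<ge>N. X n - f \<in> hspace (l2_space I) \<and> hnorm (l2_space I) (X n - f) \<le> e"
    if e: "e > 0" for e :: real
  proof -
    obtain N where N: "\<forall>m\<ge>N. \<forall>n\<ge>N. hnorm (l2_space I) (X m - X n) < e"
      using cauchy e by blast
    \<comment> \<open>With \<open>F\<close> and \<open>n\<close> fixed, let \<open>m\<close> tend to
      infinity in the bound on \<open>X n - X m\<close>.\<close>
    have "(\<Sum>x\<in>F. (cmod ((X n - f) x))\<^sup>2) \<le> e\<^sup>2" if F: "finite F" "F \<subseteq> I" and n: "n \<ge> N" for F n
    proof (rule LIMSEQ_le_const2)
      show "(\<lambda>m. \<Sum>x\<in>F. (cmod (X n x - X m x))\<^sup>2) \<longlonglongrightarrow> (\<Sum>x\<in>F. (cmod ((X n - f) x))\<^sup>2)"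
        using F by (auto intro!: tendsto_intros l simp: f_def subset_iff)
      have "(\<Sum>x\<in>F. (cmod (X n x - X m x))\<^sup>2) \<le> e\<^sup>2" if "m \<ge> N" for m
      proof -
        have "(\<Sum>x\<in>F. (cmod (X n x - X m x))\<^sup>2) \<le> (hnorm (l2_space I) (X n - X m))\<^sup>2"
          using l2_finite_sum_le[OF diff[OF X[of n] X[of m]] F] by simp
        also have "\<dots> \<le> e\<^sup>2"
          using N n that by (intro power_mono hnorm_l2_nonneg diff X) (auto intro: less_imp_le)
        finally show ?thesis .
      qed
      then show "\<exists>M. \<forall>m\<ge>M. (\<Sum>x\<in>F. (cmod (X n x - X m x))\<^sup>2) \<le> e\<^sup>2" by blast
    qed
    moreover have "(X n - f) x = 0" if "x \<notin> I" for n x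
      using X[of n] that by (simp add: l2_space_simps f_def)
    ultimately show ?thesis
      using l2_space_memI[of I "X _ - f" e] e by (metis less_imp_le)
  qed
  obtain N where N: "X N - f \<in> hspace (l2_space I)"
    using near[of 1] by auto
  \<comment> \<open>The pointwise limit is square-summable as the difference of \<open>X N\<close>
    and \<open>X N - f\<close>.\<close>
  have f: "f \<in> hspace (l2_space I)"
    using diff[OF X[of N] N] by simp
  have "(\<lambda>n. hnorm (l2_space I) (X n - f)) \<longlonglongrightarrow> 0"
  proof (rule LIMSEQ_I)
    fix e :: real assume "e > 0"
    then obtain N where "\<forall>n\<ge>N. hnorm (l2_space I) (X n - f) \<le> e / 2"
      using near[of "e / 2"] by auto
    moreover have "0 \<le> hnorm (l2_space I) (X n - f)" for n
      by (intro hnorm_l2_nonneg diff X f)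
    ultimately show "\<exists>N. \<forall>n\<ge>N. norm (hnorm (l2_space I) (X n - f) - 0) < e"
      using \<open>e > 0\<close> by (intro exI[of _ N]) (auto simp: abs_of_nonneg intro: le_less_trans)
  qed
  with f show ?thesis by blast
qed

lemma hilbert_l2_space: "complex_hilbert_space (l2_space I)"
proof -
  interpret vector_space "hscale (l2_space I)"
    unfolding l2_space_simps by (rule vector_space_fun_scale)
  show ?thesis
  proof (unfold_locales, goal_cases)
    case 1
    then show ?case using subspace_l2_space by (simp add: l2_space_simps(1))
  next
    case (2 f h)
    have "(\<Sum>\<^sub>\<infinity>x\<in>I. cnj (h x) * f x) = (\<Sum>\<^sub>\<infinity>x\<in>I. cnj (cnj (f x) * h x))"
      by (simp add: mult.commute)
    then show ?case by (simp only: l2_space_simps infsum_cnj)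
  next
    case (3 f h k)
    then show ?case
      using infsum_add[OF l2_summable_product[of f I h] l2_summable_product[of f I k]]
      by (simp add: l2_space_simps distrib_left)
  next
    case (4 f h c)
    then show ?case
      using infsum_cmult_right[OF l2_summable_product[of f I h], of c]
      by (simp add: l2_space_simps mult.left_commute)
  next
    case (5 f)
    then obtain x where x: "f x \<noteq> 0" by (auto simp: fun_eq_iff)
    with 5 have "x \<in> I" by (auto simp: l2_space_simps)
    then have "0 < (hnorm (l2_space I) f)\<^sup>2"
      using l2_finite_sum_le[OF 5(1), of "{x}"] x by (auto intro: less_le_trans[rotated])
    moreover have "0 \<le> hnorm (l2_space I) f"
      using 5(1) by (rule hnorm_l2_nonneg)
    ultimately show ?case by (auto simp: hnorm_def zero_less_power_eq)
  next
    case (6 X)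
    then show ?case by (rule l2_space_complete)
  qed
qed

section \<open>The left regular representation and trivial representations\<close>

context group
begin

text \<open>The cut-off to 0 outside the group keeps translates inside
  \<open>l2_space (carrier G)\<close>, since \<open>inv g \<otimes> x\<close> means nothing for
  other \<open>x\<close>.\<close>

definition regular_rep :: "'a \<Rightarrow> ('a \<Rightarrow> complex) \<Rightarrow> 'a \<Rightarrow> complex" where
  "regular_rep g f = (\<lambda>x. if x \<in> carrier G then f (inv g \<otimes> x) else 0)"

lemma bij_betw_left_mult: "g \<in> carrier G \<Longrightarrow> bij_betw (\<lambda>x. g \<otimes> x) (carrier G) (carrier G)"
  by (rule bij_betwI[where g="\<lambda>x. inv g \<otimes> x"]) (auto simp: m_assoc[symmetric])

lemma regular_rep_mult:
  assumes "g \<in> carrier G" "h \<in> carrier G"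
  shows "regular_rep (g \<otimes> h) f = regular_rep g (regular_rep h f)"
  using assms by (auto simp: regular_rep_def fun_eq_iff inv_mult_group m_assoc)

lemma regular_rep_one:
  "f \<in> hspace (l2_space (carrier G)) \<Longrightarrow> regular_rep \<one> f = f"
  by (auto simp: regular_rep_def fun_eq_iff l2_space_simps)

lemma regular_rep_space:
  assumes "g \<in> carrier G" "f \<in> hspace (l2_space (carrier G))"
  shows "regular_rep g f \<in> hspace (l2_space (carrier G))"
  using assms summable_on_reindex_bij_betw[OF bij_betw_left_mult[of "inv g"], of "\<lambda>x. (cmod (f x))\<^sup>2"]
  by (auto simp: regular_rep_def l2_space_simps cong: summable_on_cong)

lemma unitary_regular_rep: "unitary_rep G (l2_space (carrier G)) regular_rep"
proof -
  have inner: "hinner (l2_space (carrier G)) (regular_rep g f) (regular_rep g h) =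
      hinner (l2_space (carrier G)) f h" if "g \<in> carrier G" for g f h
    using that infsum_reindex_bij_betw[OF bij_betw_left_mult[of "inv g"], of "\<lambda>x. cnj (f x) * h x"]
    by (simp add: l2_space_simps regular_rep_def cong: infsum_cong)
  have "bij_betw (regular_rep g) (hspace (l2_space (carrier G))) (hspace (l2_space (carrier G)))"
    if "g \<in> carrier G" for g
    using that
    by (intro bij_betwI[where g="regular_rep (inv g)"])
      (auto simp: regular_rep_space regular_rep_one simp flip: regular_rep_mult)
  then show ?thesis
    unfolding unitary_rep_def unitary_operator_def linear_operator_def
    using inner hilbert_l2_space
    by (auto simp: regular_rep_space regular_rep_mult regular_rep_one)
      (auto simp: regular_rep_def fun_eq_iff l2_space_simps)
qed

lemma unitary_trivial_rep: "complex_hilbert_space H \<Longrightarrow> unitary_rep G H (\<lambda>g x. x)"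
  unfolding unitary_rep_def unitary_operator_def linear_operator_def by (auto simp: bij_betw_def inj_on_def)

end


section \<open>The group algebra and its full norm\<close>

context group
begin

abbreviation CG :: "('a \<Rightarrow> complex) star_algebra" where
  "CG \<equiv> group_star_algebra G"

text \<open>These functions play two roles: as elements of the group algebra they represent the
  group elements, and as vectors they form the standard basis of \<open>l2_space\<close>.\<close>

definition point_mass :: "'a \<Rightarrow> 'a \<Rightarrow> complex" where
  "point_mass g = (\<lambda>x. if x = g then 1 else 0)"

text \<open>On finitely supported functions this is the character by which the group algebra acts in
  a trivial representation.\<close>

definition augmentation :: "('a \<Rightarrow> complex) \<Rightarrow> complex" where
  "augmentation f = (\<Sum>g | f g \<noteq> 0. f g)"

lemma carrier_CG:
  "f \<in> carrier CG \<longleftrightarrow> finite {g. f g \<noteq> 0} \<and> {g. f g \<noteq> 0} \<subseteq> carrier G"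
  by (simp add: group_star_algebra_def)

lemma CG_memI: "finite F \<Longrightarrow> F \<subseteq> carrier G \<Longrightarrow> (\<And>g. f g \<noteq> 0 \<Longrightarrow> g \<in> F) \<Longrightarrow> f \<in> carrier CG"
  unfolding carrier_CG by (auto intro: finite_subset)

lemma CG_mult:
  "f \<otimes>\<^bsub>CG\<^esub> h = (\<lambda>x. if x \<in> carrier G then \<Sum>y | f y \<noteq> 0. f y * h (inv y \<otimes> x) else 0)"
  by (simp add: group_star_algebra_def)

lemma augmentation_superset:
  assumes "finite F" "\<And>g. f g \<noteq> 0 \<Longrightarrow> g \<in> F"
  shows "augmentation f = (\<Sum>g\<in>F. f g)"
  unfolding augmentation_def by (rule sum.mono_neutral_left) (use assms in auto)

lemma point_mass_CG [simp]: "g \<in> carrier G \<Longrightarrow> point_mass g \<in> carrier CG"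
  by (rule CG_memI[of "{g}"]) (auto simp: point_mass_def split: if_splits)

lemma augmentation_point_mass: "augmentation (point_mass g) = 1"
  by (subst augmentation_superset[of "{g}"]) (auto simp: point_mass_def split: if_splits)

lemma CG_diff_closed: "f \<in> carrier CG \<Longrightarrow> h \<in> carrier CG \<Longrightarrow> f - h \<in> carrier CG"
  by (rule CG_memI[of "{g. f g \<noteq> 0} \<union> {g. h g \<noteq> 0}"]) (auto simp: carrier_CG)

lemma CG_smult_closed: "f \<in> carrier CG \<Longrightarrow> (\<lambda>x. c * f x) \<in> carrier CG"
  by (rule CG_memI[of "{g. f g \<noteq> 0}"]) (auto simp: carrier_CG)

text \<open>A nonzero convolution sum has a nonzero term at some \<open>y\<close>, and then
  \<open>x\<close> factors as \<open>y\<close> times \<open>inv y \<otimes> x\<close>. Besides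
  finiteness of the support, this supplies the index set for \<open>integrated_mult\<close>.\<close>

lemma support_CG_mult:
  assumes "f \<in> carrier CG" "h \<in> carrier CG" "(f \<otimes>\<^bsub>CG\<^esub> h) x \<noteq> 0"
  shows "x \<in> (\<lambda>(y, z). y \<otimes> z) ` ({g. f g \<noteq> 0} \<times> {g. h g \<noteq> 0})"
proof -
  have x: "x \<in> carrier G" and "(\<Sum>y | f y \<noteq> 0. f y * h (inv y \<otimes> x)) \<noteq> 0"
    using assms(3) by (auto simp: CG_mult split: if_splits)
  then obtain y where y: "f y \<noteq> 0" "h (inv y \<otimes> x) \<noteq> 0"
    by (auto elim: sum.not_neutral_contains_not_neutral)
  then have "x = y \<otimes> (inv y \<otimes> x)"
    using x assms(1) by (auto simp: carrier_CG m_assoc[symmetric] subset_iff)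
  then show ?thesis using y by force
qed

lemma CG_mult_closed:
  assumes "f \<in> carrier CG" "h \<in> carrier CG"
  shows "f \<otimes>\<^bsub>CG\<^esub> h \<in> carrier CG"
  by (rule CG_memI[OF _ _ support_CG_mult[OF assms]])
    (use assms in \<open>auto simp: carrier_CG subset_iff\<close>)

lemma augmentation_diff:
  assumes "f \<in> carrier CG" "h \<in> carrier CG"
  shows "augmentation (f - h) = augmentation f - augmentation h"
proof -
  let ?F = "{g. f g \<noteq> 0} \<union> {g. h g \<noteq> 0}"
  have "augmentation (f - h) = (\<Sum>g\<in>?F. (f - h) g)" "augmentation f = (\<Sum>g\<in>?F. f g)"
    "augmentation h = (\<Sum>g\<in>?F. h g)"
    by (rule augmentation_superset; use assms in \<open>auto simp: carrier_CG\<close>)+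
  then show ?thesis by (simp add: sum_subtractf)
qed

end

section \<open>The integrated form of a unitary representation\<close>

locale unitary_representation = group G + complex_hilbert_space H
  for G :: "('g, 'm) monoid_scheme" (structure) and H :: "'h::ab_group_add hilbert" +
  fixes \<pi> :: "'g \<Rightarrow> 'h \<Rightarrow> 'h"
  assumes unitary: "unitary_rep G H \<pi>"
begin

lemma rep_closed: "g \<in> carrier G \<Longrightarrow> x \<in> hspace H \<Longrightarrow> \<pi> g x \<in> hspace H"
  and rep_add: "g \<in> carrier G \<Longrightarrow> x \<in> hspace H \<Longrightarrow> y \<in> hspace H \<Longrightarrow> \<pi> g (x + y) = \<pi> g x + \<pi> g y"
  and rep_scale: "g \<in> carrier G \<Longrightarrow> x \<in> hspace H \<Longrightarrow> \<pi> g (hscale H c x) = hscale H c (\<pi> g x)"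
  and rep_hinner: "g \<in> carrier G \<Longrightarrow> x \<in> hspace H \<Longrightarrow> y \<in> hspace H \<Longrightarrow>
    hinner H (\<pi> g x) (\<pi> g y) = hinner H x y"
  and rep_one: "x \<in> hspace H \<Longrightarrow> \<pi> \<one> x = x"
  and rep_mult: "g \<in> carrier G \<Longrightarrow> h \<in> carrier G \<Longrightarrow> x \<in> hspace H \<Longrightarrow> \<pi> (g \<otimes> h) x = \<pi> g (\<pi> h x)"
  using unitary by (auto simp: unitary_rep_def unitary_operator_def linear_operator_def)

lemma rep_hnorm: "g \<in> carrier G \<Longrightarrow> x \<in> hspace H \<Longrightarrow> hnorm H (\<pi> g x) = hnorm H x"
  by (simp add: hnorm_def rep_hinner)

lemma rep_zero: "g \<in> carrier G \<Longrightarrow> \<pi> g 0 = 0"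
  using rep_add[of g 0 0] by simp

lemma rep_sum:
  assumes "finite F" "g \<in> carrier G" "\<And>i. i \<in> F \<Longrightarrow> f i \<in> hspace H"
  shows "\<pi> g (sum f F) = (\<Sum>i\<in>F. \<pi> g (f i))"
  using assms by (induction F rule: finite_induct) (auto simp: rep_zero rep_add sum_hspace)

abbreviation \<Phi> :: "('g \<Rightarrow> complex) \<Rightarrow> 'h \<Rightarrow> 'h" where
  "\<Phi> \<equiv> integrated_rep H \<pi>"

lemma integrated_superset:
  assumes "finite F" "\<And>g. f g \<noteq> 0 \<Longrightarrow> g \<in> F"
  shows "\<Phi> f x = (\<Sum>g\<in>F. hscale H (f g) (\<pi> g x))"
  unfolding integrated_rep_def by (rule sum.mono_neutral_left) (use assms in auto)

lemma CG_support: "f \<in> carrier CG \<Longrightarrow> f g \<noteq> 0 \<Longrightarrow> g \<in> carrier G"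
  and CG_finite: "f \<in> carrier CG \<Longrightarrow> finite {g. f g \<noteq> 0}"
  by (auto simp: carrier_CG)

lemma integrated_closed: "f \<in> carrier CG \<Longrightarrow> x \<in> hspace H \<Longrightarrow> \<Phi> f x \<in> hspace H"
  unfolding integrated_rep_def by (intro hspace_intros rep_closed) (auto intro: CG_support)

lemma integrated_point_mass: "\<Phi> (point_mass g) x = \<pi> g x"
  by (subst integrated_superset[of "{g}"]) (auto simp: point_mass_def split: if_splits)

lemma integrated_smult: "f \<in> carrier CG \<Longrightarrow> \<Phi> (\<lambda>x. c * f x) x = hscale H c (\<Phi> f x)"
  by (subst (1 2) integrated_superset[of "{g. f g \<noteq> 0}"])
    (auto simp: CG_finite scale_sum_right)

lemma integrated_add:
  assumes "f \<in> carrier CG" "h \<in> carrier CG"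
  shows "\<Phi> (f + h) x = \<Phi> f x + \<Phi> h x"
  by (subst (1 2 3) integrated_superset[of "{g. f g \<noteq> 0} \<union> {g. h g \<noteq> 0}"])
    (use assms in \<open>auto simp: CG_finite scale_left_distrib sum.distrib\<close>)

lemma integrated_diff:
  assumes "f \<in> carrier CG" "h \<in> carrier CG"
  shows "\<Phi> (f - h) x = \<Phi> f x - \<Phi> h x"
  by (subst (1 2 3) integrated_superset[of "{g. f g \<noteq> 0} \<union> {g. h g \<noteq> 0}"])
    (use assms in \<open>auto simp: CG_finite scale_left_diff_distrib sum_subtractf\<close>)

lemma integrated_add_arg:
  assumes "f \<in> carrier CG" "x \<in> hspace H" "y \<in> hspace H"
  shows "\<Phi> f (x + y) = \<Phi> f x + \<Phi> f y"
proof -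
  have "hscale H (f g) (\<pi> g (x + y)) = hscale H (f g) (\<pi> g x) + hscale H (f g) (\<pi> g y)"
    if "f g \<noteq> 0" for g
    using that assms by (simp add: rep_add CG_support scale_right_distrib)
  then show ?thesis
    unfolding integrated_rep_def by (simp add: sum.distrib)
qed

lemma integrated_diff_arg:
  assumes "f \<in> carrier CG" "x \<in> hspace H" "y \<in> hspace H"
  shows "\<Phi> f (x - y) = \<Phi> f x - \<Phi> f y"
  using integrated_add_arg[OF assms(1), of "x - y" y] assms by (simp add: diff_hspace)

lemma integrated_scale_arg:
  assumes "f \<in> carrier CG" "x \<in> hspace H"
  shows "\<Phi> f (hscale H c x) = hscale H c (\<Phi> f x)"
proof -
  have "hscale H (f g) (\<pi> g (hscale H c x)) = hscale H c (hscale H (f g) (\<pi> g x))"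
    if "f g \<noteq> 0" for g
    using that assms by (simp add: rep_scale CG_support mult.commute)
  then show ?thesis
    unfolding integrated_rep_def by (simp add: scale_sum_right)
qed

text \<open>After the two finite sums are exchanged, the substitution
  \<open>u = y \<otimes> z\<close> turns the inner sum into
  \<open>\<pi> y (\<Phi> h x)\<close>.\<close>

lemma integrated_mult:
  assumes f: "f \<in> carrier CG" and h: "h \<in> carrier CG" and x: "x \<in> hspace H"
  shows "\<Phi> (f \<otimes>\<^bsub>CG\<^esub> h) x = \<Phi> f (\<Phi> h x)"
proof -
  let ?F = "{g. f g \<noteq> 0}" and ?E = "{g. h g \<noteq> 0}"
  let ?P = "(\<lambda>(y, z). y \<otimes> z) ` (?F \<times> ?E)"
  have fin: "finite ?F" "finite ?E" "finite ?P"
    using CG_finite[OF f] CG_finite[OF h] by auto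
  have F: "y \<in> carrier G" if "y \<in> ?F" for y using that CG_support[OF f] by auto
  have E: "y \<in> carrier G" if "y \<in> ?E" for y using that CG_support[OF h] by auto
  have P: "u \<in> carrier G" if "u \<in> ?P" for u using that F E by auto
  \<comment> \<open>\<open>?P\<close> serves all \<open>y\<close> at once. For a single
    \<open>y\<close> only the translate of the support of \<open>h\<close> by \<open>y\<close>
    contributes.\<close>
  have translate: "(\<Sum>u\<in>?P. hscale H (h (inv y \<otimes> u)) (\<pi> u x)) = \<pi> y (\<Phi> h x)" if y: "y \<in> ?F" for y
  proof -
    have "(\<Sum>u\<in>?P. hscale H (h (inv y \<otimes> u)) (\<pi> u x)) =
        (\<Sum>u\<in>(\<lambda>z. y \<otimes> z) ` ?E. hscale H (h (inv y \<otimes> u)) (\<pi> u x))"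
    proof (rule sum.mono_neutral_right)
      show "\<forall>u\<in>?P - (\<lambda>z. y \<otimes> z) ` ?E. hscale H (h (inv y \<otimes> u)) (\<pi> u x) = 0"
      proof
        fix u assume u: "u \<in> ?P - (\<lambda>z. y \<otimes> z) ` ?E"
        have "u = y \<otimes> (inv y \<otimes> u)"
          using P u F[OF y] by (simp add: m_assoc[symmetric])
        then have "h (inv y \<otimes> u) = 0" using u by blast
        then show "hscale H (h (inv y \<otimes> u)) (\<pi> u x) = 0" by simp
      qed
    qed (use fin y in auto)
    also have "\<dots> = (\<Sum>z\<in>?E. hscale H (h z) (\<pi> (y \<otimes> z) x))"
    proof (subst sum.reindex)
      show "inj_on (\<lambda>z. y \<otimes> z) ?E"
        using F[OF y] E by (auto simp: inj_on_def)
      show "sum ((\<lambda>u. hscale H (h (inv y \<otimes> u)) (\<pi> u x)) \<circ> (\<otimes>) y) ?E =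
          (\<Sum>z\<in>?E. hscale H (h z) (\<pi> (y \<otimes> z) x))"
        using F[OF y] E by (intro sum.cong) (auto simp: m_assoc[symmetric])
    qed
    also have "\<dots> = (\<Sum>z\<in>?E. \<pi> y (hscale H (h z) (\<pi> z x)))"
      using F[OF y] E x by (intro sum.cong) (auto simp: rep_mult rep_scale rep_closed)
    also have "\<dots> = \<pi> y (\<Phi> h x)"
      unfolding integrated_rep_def using F[OF y] E x fin
      by (intro rep_sum[symmetric]) (auto simp: scale_hspace rep_closed)
    finally show ?thesis .
  qed
  have "\<Phi> (f \<otimes>\<^bsub>CG\<^esub> h) x = (\<Sum>u\<in>?P. hscale H ((f \<otimes>\<^bsub>CG\<^esub> h) u) (\<pi> u x))"
    using support_CG_mult[OF f h] fin by (intro integrated_superset) auto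
  also have "\<dots> = (\<Sum>u\<in>?P. \<Sum>y\<in>?F. hscale H (f y) (hscale H (h (inv y \<otimes> u)) (\<pi> u x)))"
    using P by (intro sum.cong) (auto simp: CG_mult scale_sum_left)
  also have "\<dots> = (\<Sum>y\<in>?F. hscale H (f y) (\<Sum>u\<in>?P. hscale H (h (inv y \<otimes> u)) (\<pi> u x)))"
    by (subst sum.swap) (simp add: scale_sum_right)
  also have "\<dots> = (\<Sum>y\<in>?F. hscale H (f y) (\<pi> y (\<Phi> h x)))"
    using translate by (intro sum.cong) auto
  finally show ?thesis by (simp add: integrated_rep_def)
qed

text \<open>Triangle inequality and unitarity. The constant depends on \<open>f\<close> only, so it
  bounds the suprema in both \<open>opnorm\<close> and \<open>full_norm\<close>.\<close>

lemma hnorm_integrated_le_l1: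
  assumes f: "f \<in> carrier CG" and x: "x \<in> hspace H"
  shows "hnorm H (\<Phi> f x) \<le> (\<Sum>g | f g \<noteq> 0. cmod (f g)) * hnorm H x"
proof -
  have "hnorm H (\<Phi> f x) \<le> (\<Sum>g | f g \<noteq> 0. hnorm H (hscale H (f g) (\<pi> g x)))"
    unfolding integrated_rep_def using f x
    by (intro hnorm_sum) (auto simp: scale_hspace rep_closed CG_support CG_finite)
  also have "\<dots> = (\<Sum>g | f g \<noteq> 0. cmod (f g) * hnorm H x)"
    using f x by (intro sum.cong) (auto simp: hnorm_scale rep_closed rep_hnorm CG_support)
  finally show ?thesis by (simp add: sum_distrib_right)
qed

lemma opnorm_le:
  assumes "K \<ge> 0" "\<And>x. x \<in> hspace H \<Longrightarrow> hnorm H (T x) \<le> K * hnorm H x"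
  shows "opnorm H T \<le> K"
  unfolding opnorm_def
proof (rule cSUP_least)
  show "{x \<in> hspace H. hnorm H x \<le> 1} \<noteq> {}"
    using zero_hspace hnorm_zero by (auto intro!: exI[of _ 0])
  show "hnorm H (T x) \<le> K" if "x \<in> {x \<in> hspace H. hnorm H x \<le> 1}" for x
    using that assms(2)[of x] mult_left_mono[of "hnorm H x" 1 K] assms(1) by simp
qed

text \<open>A nonzero \<open>x\<close> is rescaled to the unit vector \<open>u\<close>, where the
  supremum applies because the l1 bound makes it a supremum of a bounded set.\<close>

lemma hnorm_le_opnorm:
  assumes f: "f \<in> carrier CG" and x: "x \<in> hspace H"
  shows "hnorm H (\<Phi> f x) \<le> opnorm H (\<Phi> f) * hnorm H x"
proof (cases "x = 0")
  case True
  then show ?thesis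
    using integrated_scale_arg[OF f x, of 0] by simp
next
  case False
  define K where "K = (\<Sum>g | f g \<noteq> 0. cmod (f g))"
  define u where "u = hscale H (inverse (complex_of_real (hnorm H x))) x"
  have pos: "hnorm H x > 0" using x False by (rule hnorm_pos)
  have u: "u \<in> hspace H" "hnorm H u = 1"
    using pos x by (auto simp: u_def scale_hspace hnorm_scale norm_inverse)
  have "hnorm H (\<Phi> f u) \<le> opnorm H (\<Phi> f)"
    unfolding opnorm_def
  proof (rule cSUP_upper)
    have "K \<ge> 0" by (simp add: K_def sum_nonneg)
    then show "bdd_above ((\<lambda>x. hnorm H (\<Phi> f x)) ` {x \<in> hspace H. hnorm H x \<le> 1})"
      using hnorm_integrated_le_l1[OF f] mult_left_mono[of _ 1 K]
      by (intro bdd_aboveI[of _ K]) (force simp: K_def)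
  qed (use u in auto)
  moreover have "\<Phi> f u = hscale H (inverse (complex_of_real (hnorm H x))) (\<Phi> f x)"
    unfolding u_def by (rule integrated_scale_arg[OF f x])
  then have "hnorm H (\<Phi> f u) = inverse (hnorm H x) * hnorm H (\<Phi> f x)"
    using pos f x by (simp add: hnorm_scale integrated_closed norm_inverse)
  ultimately show ?thesis
    using pos by (simp add: field_simps)
qed

end

section \<open>The full norm as a submultiplicative seminorm\<close>

context group
begin

lemma unitary_representationI: "unitary_rep G H \<pi> \<Longrightarrow> unitary_representation G H \<pi>"
  unfolding unitary_representation_def unitary_representation_axioms_def
  using group_axioms by (auto simp: unitary_rep_def)

text \<open>Together with \<open>full_norm_le\<close> this replaces the supremum: estimates on all
  vectors of all representations yield estimates of the full norm, and conversely.\<close>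

lemma hnorm_integrated_le:
  fixes H :: "('a \<Rightarrow> complex) hilbert"
  assumes f: "f \<in> carrier CG" and rep: "unitary_rep G H \<pi>" and x: "x \<in> hspace H"
  shows "hnorm H (integrated_rep H \<pi> f x) \<le> full_norm G f * hnorm H x"
proof -
  interpret unitary_representation G H \<pi> by (rule unitary_representationI[OF rep])
  have "opnorm H (integrated_rep H \<pi> f) \<le> full_norm G f"
    unfolding full_norm_def
  proof (rule cSup_upper)
    show "bdd_above {opnorm H (integrated_rep H \<pi> f) | (H :: ('a \<Rightarrow> complex) hilbert) \<pi>.
      unitary_rep G H \<pi>}"
    proof (rule bdd_aboveI, clarify)
      fix H' :: "('a \<Rightarrow> complex) hilbert" and \<pi>'
      assume "unitary_rep G H' \<pi>'"
      then interpret R: unitary_representation G H' \<pi>' by (rule unitary_representationI)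
      show "opnorm H' (R.\<Phi> f) \<le> (\<Sum>g | f g \<noteq> 0. cmod (f g))"
        by (rule R.opnorm_le) (auto simp: sum_nonneg R.hnorm_integrated_le_l1 f)
    qed
  qed (use rep in blast)
  then have "opnorm H (\<Phi> f) * hnorm H x \<le> full_norm G f * hnorm H x"
    using x by (intro mult_right_mono hnorm_nonneg)
  with hnorm_le_opnorm[OF f x] show ?thesis by linarith
qed

lemma full_norm_le:
  assumes "K \<ge> 0"
    and "\<And>(H :: ('a \<Rightarrow> complex) hilbert) \<pi> x. unitary_rep G H \<pi> \<Longrightarrow> x \<in> hspace H \<Longrightarrow>
      hnorm H (integrated_rep H \<pi> f x) \<le> K * hnorm H x"
  shows "full_norm G f \<le> K"
  unfolding full_norm_def
proof (rule cSup_least)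
  show "{opnorm H (integrated_rep H \<pi> f) | (H :: ('a \<Rightarrow> complex) hilbert) \<pi>.
      unitary_rep G H \<pi>} \<noteq> {}"
    using unitary_regular_rep by blast
  fix y assume "y \<in> {opnorm H (integrated_rep H \<pi> f) | (H :: ('a \<Rightarrow> complex) hilbert) \<pi>.
      unitary_rep G H \<pi>}"
  then obtain H :: "('a \<Rightarrow> complex) hilbert" and \<pi>
    where y: "y = opnorm H (integrated_rep H \<pi> f)" and rep: "unitary_rep G H \<pi>" by blast
  interpret unitary_representation G H \<pi> by (rule unitary_representationI[OF rep])
  show "y \<le> K" unfolding y using assms rep by (intro opnorm_le) auto
qed

lemma point_mass_l2: "g \<in> I \<Longrightarrow> point_mass g \<in> hspace (l2_space I)"
  using finite_nonzero_values_imp_summable_on[of I "\<lambda>x. (cmod (point_mass g x))\<^sup>2"]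
  by (auto simp: l2_space_simps point_mass_def split: if_splits)

lemma point_mass_nonzero: "point_mass g \<noteq> 0"
  by (auto simp: fun_eq_iff point_mass_def intro: exI[of _ g])

lemma hnorm_point_mass_pos: "g \<in> I \<Longrightarrow> 0 < hnorm (l2_space I) (point_mass g)"
  by (intro complex_hilbert_space.hnorm_pos hilbert_l2_space point_mass_l2 point_mass_nonzero)

text \<open>The trivial representation on the one-dimensional space \<open>l2_space {\<one>}\<close>
  takes part in the supremum. Hence the augmentation is continuous for the full norm, which lets it
  be evaluated on Cauchy sequences and gives lower bounds for norms.\<close>

lemma cmod_augmentation_le:
  assumes f: "f \<in> carrier CG"
  shows "cmod (augmentation f) \<le> full_norm G f"
proof -
  let ?H = "l2_space {\<one>}"
  interpret complex_hilbert_space ?H by (rule hilbert_l2_space)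
  have mem: "point_mass \<one> \<in> hspace ?H" by (simp add: point_mass_l2)
  have "integrated_rep ?H (\<lambda>g x. x) f (point_mass \<one>) = hscale ?H (augmentation f) (point_mass \<one>)"
    by (simp add: integrated_rep_def augmentation_def scale_sum_left)
  then have "cmod (augmentation f) * hnorm ?H (point_mass \<one>) \<le> full_norm G f * hnorm ?H (point_mass \<one>)"
    using hnorm_integrated_le[OF f unitary_trivial_rep[OF hilbert_l2_space] mem]
    by (simp add: hnorm_scale mem)
  then show ?thesis using hnorm_point_mass_pos[of "\<one>" "{\<one>}"] by simp
qed

lemma full_norm_nonneg: "f \<in> carrier CG \<Longrightarrow> 0 \<le> full_norm G f"
  using cmod_augmentation_le[of f] norm_ge_zero[of "augmentation f"] by linarith

lemma full_norm_add:
  assumes f: "f \<in> carrier CG" and h: "h \<in> carrier CG"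
  shows "full_norm G (f + h) \<le> full_norm G f + full_norm G h"
proof (rule full_norm_le)
  fix H :: "('a \<Rightarrow> complex) hilbert" and \<pi> x
  assume rep: "unitary_rep G H \<pi>" and x: "x \<in> hspace H"
  interpret unitary_representation G H \<pi> by (rule unitary_representationI[OF rep])
  show "hnorm H (\<Phi> (f + h) x) \<le> (full_norm G f + full_norm G h) * hnorm H x"
    using hnorm_triangle[of "\<Phi> f x" "\<Phi> h x"] hnorm_integrated_le[OF f rep x]
      hnorm_integrated_le[OF h rep x] f h x
    by (simp add: integrated_add integrated_closed distrib_right)
qed (simp add: full_norm_nonneg f h)

lemma full_norm_smult:
  assumes f: "f \<in> carrier CG"
  shows "full_norm G (\<lambda>x. c * f x) \<le> cmod c * full_norm G f"
proof (rule full_norm_le)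
  fix H :: "('a \<Rightarrow> complex) hilbert" and \<pi> x
  assume rep: "unitary_rep G H \<pi>" and x: "x \<in> hspace H"
  interpret unitary_representation G H \<pi> by (rule unitary_representationI[OF rep])
  show "hnorm H (\<Phi> (\<lambda>x. c * f x) x) \<le> cmod c * full_norm G f * hnorm H x"
    using hnorm_integrated_le[OF f rep x] f x
    by (simp add: integrated_smult hnorm_scale integrated_closed mult.assoc mult_left_mono)
qed (simp add: full_norm_nonneg f)

lemma full_norm_mult:
  assumes f: "f \<in> carrier CG" and h: "h \<in> carrier CG"
  shows "full_norm G (f \<otimes>\<^bsub>CG\<^esub> h) \<le> full_norm G f * full_norm G h"
proof (rule full_norm_le)
  fix H :: "('a \<Rightarrow> complex) hilbert" and \<pi> x
  assume rep: "unitary_rep G H \<pi>" and x: "x \<in> hspace H"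
  interpret unitary_representation G H \<pi> by (rule unitary_representationI[OF rep])
  have "hnorm H (\<Phi> f (\<Phi> h x)) \<le> full_norm G f * hnorm H (\<Phi> h x)"
    using hnorm_integrated_le[OF f rep] h x by (simp add: integrated_closed)
  also have "\<dots> \<le> full_norm G f * (full_norm G h * hnorm H x)"
    using hnorm_integrated_le[OF h rep x] by (intro mult_left_mono full_norm_nonneg f)
  finally show "hnorm H (\<Phi> (f \<otimes>\<^bsub>CG\<^esub> h) x) \<le> full_norm G f * full_norm G h * hnorm H x"
    using f h x by (simp add: integrated_mult mult.assoc)
qed (simp add: full_norm_nonneg f h)

lemma full_norm_minus_commute:
  assumes "f \<in> carrier CG" "h \<in> carrier CG"
  shows "full_norm G (f - h) = full_norm G (h - f)"
proof -
  have "full_norm G (f - h) \<le> full_norm G (h - f)"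
    if "f \<in> carrier CG" "h \<in> carrier CG" for f h
    using full_norm_smult[OF CG_diff_closed[OF that(2,1)], of "-1"] by (simp add: fun_diff_def)
  then show ?thesis using assms by (simp add: order_antisym)
qed

lemma full_norm_diff_triangle:
  assumes "f \<in> carrier CG" "h \<in> carrier CG" "k \<in> carrier CG"
  shows "full_norm G (f - k) \<le> full_norm G (f - h) + full_norm G (h - k)"
  using full_norm_add[of "f - h" "h - k"] assms by (simp add: CG_diff_closed)

text \<open>The regular representation separates group elements: \<open>g\<close> moves the basis
  vector at the unit to the basis vector at \<open>g\<close>, so a vanishing norm makes these two
  vectors equal.\<close>

lemma full_norm_point_mass_diff:
  assumes g: "g \<in> carrier G" and 0: "full_norm G (point_mass g - point_mass \<one>) \<le> 0"
  shows "g = \<one>"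
proof -
  let ?H = "l2_space (carrier G)"
  interpret unitary_representation G ?H regular_rep
    by (rule unitary_representationI[OF unitary_regular_rep])
  have mem: "point_mass \<one> \<in> hspace ?H" by (simp add: point_mass_l2)
  have "\<Phi> (point_mass g - point_mass \<one>) (point_mass \<one>) = regular_rep g (point_mass \<one>) - point_mass \<one>"
    using g mem by (simp add: integrated_diff integrated_point_mass regular_rep_one)
  moreover have "hnorm ?H (\<Phi> (point_mass g - point_mass \<one>) (point_mass \<one>)) \<le> 0"
    using hnorm_integrated_le[OF CG_diff_closed unitary_regular_rep mem, of "point_mass g" "point_mass \<one>"]
      mult_right_mono[OF 0 hnorm_nonneg[OF mem]] g by simp
  ultimately have "regular_rep g (point_mass \<one>) - point_mass \<one> = 0"
    using hnorm_pos[of "regular_rep g (point_mass \<one>) - point_mass \<one>"] mem g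
    by (force simp: diff_hspace regular_rep_space)
  then have "regular_rep g (point_mass \<one>) g = point_mass \<one> g"
    by (simp add: fun_eq_iff)
  then show ?thesis
    using g by (auto simp: regular_rep_def point_mass_def split: if_splits)
qed

end


section \<open>The spectral gap\<close>

definition invariant_vectors ::
  "('g, 'm) monoid_scheme \<Rightarrow> 'h hilbert \<Rightarrow> ('g \<Rightarrow> 'h \<Rightarrow> 'h) \<Rightarrow> 'h set" where
  "invariant_vectors G H \<pi> = {u \<in> hspace H. \<forall>g\<in>carrier G. \<pi> g u = u}"

section \<open>Splitting off the invariant vectors\<close>

context unitary_representation
begin

abbreviation V :: "'h set" where
  "V \<equiv> orth_complement H (invariant_vectors G H \<pi>)"

lemma invariant_vectors_subset: "invariant_vectors G H \<pi> \<subseteq> hspace H"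
  by (auto simp: invariant_vectors_def)

lemma subspace_V: "subspace V"
  by (rule subspace_orth_complement[OF invariant_vectors_subset])

lemma V_hspace: "v \<in> V \<Longrightarrow> v \<in> hspace H"
  by (simp add: orth_complement_def)

lemma hinner_invariant:
  "u \<in> invariant_vectors G H \<pi> \<Longrightarrow> g \<in> carrier G \<Longrightarrow> x \<in> hspace H \<Longrightarrow>
    hinner H u (\<pi> g x) = hinner H u x"
  using rep_hinner[of g u x] by (auto simp: invariant_vectors_def)

lemma rep_V: "g \<in> carrier G \<Longrightarrow> v \<in> V \<Longrightarrow> \<pi> g v \<in> V"
  by (auto simp: orth_complement_def rep_closed hinner_invariant)

text \<open>An invariant \<open>u\<close> has the same inner product with \<open>\<pi> g x\<close>
  as with \<open>x\<close>, for any \<open>x\<close> in the whole space.\<close>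

lemma rep_diff_V: "g \<in> carrier G \<Longrightarrow> x \<in> hspace H \<Longrightarrow> \<pi> g x - x \<in> V"
  using invariant_vectors_subset
  by (auto simp: orth_complement_def rep_closed diff_hspace hinner_diff_right hinner_invariant subset_iff)

lemma integrated_diff_V:
  assumes f: "f \<in> carrier CG" and x: "x \<in> hspace H"
  shows "\<Phi> f x - hscale H (augmentation f) x \<in> V"
proof -
  have "\<Phi> f x - hscale H (augmentation f) x = (\<Sum>g | f g \<noteq> 0. hscale H (f g) (\<pi> g x - x))"
    by (simp add: integrated_rep_def augmentation_def scale_sum_left sum_subtractf scale_right_diff_distrib)
  also have "\<dots> \<in> V"
    using f x by (intro subspace_sum[OF subspace_V] subspace_scale[OF subspace_V] rep_diff_V)
      (auto intro: CG_support)
  finally show ?thesis .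
qed

lemma invariant_V_eq_0:
  assumes "v \<in> V" "\<And>g. g \<in> carrier G \<Longrightarrow> \<pi> g v = v"
  shows "v = 0"
proof -
  have "v \<in> invariant_vectors G H \<pi>"
    using assms V_hspace by (auto simp: invariant_vectors_def)
  then have "hinner H v v = 0"
    using assms(1) by (auto simp: orth_complement_def)
  then show ?thesis
    using hinner_pos[OF V_hspace[OF assms(1)]] by auto
qed

text \<open>\<open>V\<close> is stable under \<open>\<pi> g\<close> and under its inverse
  \<open>\<pi> (inv g)\<close>. The restriction has no nonzero invariant vector, so property (T)
  denies it almost invariant ones.\<close>

lemma unitary_rep_V: "unitary_rep G (H\<lparr>hspace := V\<rparr>) \<pi>"
proof -
  have "bij_betw (\<pi> g) V V" if g: "g \<in> carrier G" for g
    using g by (intro bij_betwI[where g="\<pi> (inv g)"])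
      (auto simp: rep_V V_hspace rep_one simp flip: rep_mult)
  then show ?thesis
    unfolding unitary_rep_def unitary_operator_def linear_operator_def
    using orth_complement_hilbert[OF invariant_vectors_subset]
    by (auto simp: rep_V rep_add rep_scale rep_hinner rep_one rep_mult V_hspace)
qed

text \<open>Since \<open>s\<close> moves \<open>v\<close> by a definite amount, the parallelogram
  law makes \<open>\<pi> s v + v\<close> shorter than twice \<open>v\<close>. The loss in this one
  pair persists in the average over \<open>S\<close>, where every other term has the norm of
  \<open>v\<close>. The \<open>max 0\<close> keeps the radicand nonnegative when \<epsilon> exceeds
  2.\<close>

lemma averaging_contraction:
  fixes \<epsilon> :: real
  assumes S: "finite S" "S \<subseteq> carrier G" "\<one> \<in> S"
    and s: "s \<in> S" and v: "v \<in> hspace H" "v \<noteq> 0" and \<epsilon>: "\<epsilon> > 0"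
    and moved: "\<epsilon> * hnorm H v \<le> hnorm H (\<pi> s v - v)"
  shows "hnorm H (\<Phi> (\<lambda>g. if g \<in> S then 1 / of_nat (card S) else 0) v)
    \<le> (real (card S) - 1 + sqrt (max 0 (1 - \<epsilon>\<^sup>2 / 4))) / real (card S) * hnorm H v"
proof -
  define q where "q = sqrt (max 0 (1 - \<epsilon>\<^sup>2 / 4))"
  have sG: "s \<in> carrier G" using s S by auto
  have q: "0 \<le> q" "q \<le> 1" "1 - \<epsilon>\<^sup>2 / 4 \<le> q\<^sup>2" by (auto simp: q_def)
  have nv: "hnorm H v > 0" using v by (rule hnorm_pos)
  \<comment> \<open>The unit does not move \<open>v\<close>. So the unit and \<open>s\<close> are
    two distinct members of \<open>S\<close> and can be paired.\<close>
  have "s \<noteq> \<one>"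
    using moved nv \<epsilon> v by (auto simp: rep_one mult_le_0_iff)
  have "(\<epsilon> * hnorm H v)\<^sup>2 \<le> (hnorm H (\<pi> s v - v))\<^sup>2"
    using moved nv \<epsilon> by (intro power_mono) auto
  \<comment> \<open>Parallelogram law for two vectors of equal norm.\<close>
  then have "(hnorm H (\<pi> s v + v))\<^sup>2 \<le> (4 - \<epsilon>\<^sup>2) * (hnorm H v)\<^sup>2"
    using hnorm_add_sq[of "\<pi> s v" v] hnorm_diff_sq[of "\<pi> s v" v] v sG
    by (simp add: rep_closed rep_hnorm power_mult_distrib algebra_simps)
  also have "\<dots> \<le> (4 * q\<^sup>2) * (hnorm H v)\<^sup>2"
    using q(3) by (intro mult_right_mono) auto
  also have "\<dots> = (2 * q * hnorm H v)\<^sup>2"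
    by (simp add: power_mult_distrib)
  finally have two: "hnorm H (\<pi> s v + v) \<le> 2 * q * hnorm H v"
    by (rule power2_le_imp_le) (use q nv in auto)
  let ?R = "S - {\<one>, s}"
  have cS: "real (card S) = real (card ?R) + 2"
  proof -
    have "card {\<one>, s} \<le> card S"
      using S s by (intro card_mono) auto
    moreover have "card (S - {\<one>, s}) = card S - card {\<one>, s}"
      using S s by (intro card_Diff_subset) auto
    ultimately show ?thesis using \<open>s \<noteq> \<one>\<close> by simp
  qed
  have RS: "(\<Sum>g\<in>S. \<pi> g v) = (\<pi> s v + v) + (\<Sum>g\<in>?R. \<pi> g v)"
    using S s \<open>s \<noteq> \<one>\<close> v sum.subset_diff[of "{\<one>, s}" S "\<lambda>g. \<pi> g v"]
    by (simp add: rep_one add_ac)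
  have "hnorm H (\<Sum>g\<in>?R. \<pi> g v) \<le> (\<Sum>g\<in>?R. hnorm H (\<pi> g v))"
    using S v by (intro hnorm_sum) (auto intro: rep_closed)
  also have "\<dots> = (\<Sum>g\<in>?R. hnorm H v)"
    using S v by (intro sum.cong) (auto simp: rep_hnorm)
  finally have "hnorm H (\<Sum>g\<in>?R. \<pi> g v) \<le> real (card ?R) * hnorm H v" by simp
  moreover have "\<pi> s v + v \<in> hspace H" "(\<Sum>g\<in>?R. \<pi> g v) \<in> hspace H"
    using S v sG by (auto intro!: add_hspace sum_hspace rep_closed)
  ultimately have "hnorm H (\<Sum>g\<in>S. \<pi> g v) \<le> 2 * q * hnorm H v + real (card ?R) * hnorm H v"
    unfolding RS using two hnorm_triangle by fastforce
  \<comment> \<open>The total factor \<open>card S - 2 + 2 * q\<close> is relaxed using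
    \<open>q \<le> 1\<close>.\<close>
  also have "\<dots> \<le> (real (card S) - 1 + q) * hnorm H v"
    using q nv unfolding cS by (simp add: distrib_right[symmetric])
  finally have "hnorm H (\<Sum>g\<in>S. \<pi> g v) / real (card S) \<le> (real (card S) - 1 + q) * hnorm H v / real (card S)"
    by (intro divide_right_mono) auto
  moreover have "hnorm H (\<Phi> (\<lambda>g. if g \<in> S then 1 / of_nat (card S) else 0) v)
      = hnorm H (\<Sum>g\<in>S. \<pi> g v) / real (card S)"
  proof -
    have "\<Phi> (\<lambda>g. if g \<in> S then 1 / of_nat (card S) else 0) v
        = hscale H (1 / of_nat (card S)) (\<Sum>g\<in>S. \<pi> g v)"
      using S by (subst integrated_superset[of S]) (auto simp: scale_sum_right split: if_splits)
    moreover have "(\<Sum>g\<in>S. \<pi> g v) \<in> hspace H"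
      using S v by (intro sum_hspace rep_closed) auto
    ultimately show ?thesis
      by (simp only: hnorm_scale) (simp add: norm_divide)
  qed
  ultimately show ?thesis
    by (simp add: q_def)
qed

end

context group
begin

text \<open>Property (T) is used in contrapositive form on the complement of the invariant vectors.
  The constant \<open>r\<close> is computed from the Kazhdan pair alone, hence serves all
  representations simultaneously.\<close>

lemma spectral_gap:
  assumes "kazhdan_property_T G"
  obtains f r where "f \<in> carrier CG" "augmentation f = 1" "0 \<le> r" "r < 1"
    "\<And>(H :: ('a \<Rightarrow> complex) hilbert) \<pi> v. unitary_rep G H \<pi> \<Longrightarrow>
      v \<in> orth_complement H (invariant_vectors G H \<pi>) \<Longrightarrow>
      hnorm H (integrated_rep H \<pi> f v) \<le> r * hnorm H v"
proof -
  obtain S0 \<epsilon> where S0: "finite S0" "S0 \<subseteq> carrier G" and \<epsilon>: "\<epsilon> > 0"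
    and kazhdan: "\<forall>(H :: ('a \<Rightarrow> complex) hilbert) \<pi>. unitary_rep G H \<pi> \<and>
      (\<exists>x\<in>hspace H. x \<noteq> 0 \<and> (\<forall>s\<in>S0. hnorm H (\<pi> s x - x) < \<epsilon> * hnorm H x)) \<longrightarrow>
      (\<exists>y\<in>hspace H. y \<noteq> 0 \<and> (\<forall>g\<in>carrier G. \<pi> g y = y))"
    using assms unfolding kazhdan_property_T_def by (elim exE conjE) (rule that)
  \<comment> \<open>The unit is adjoined so that the average contains the undisplaced vector
    \<open>v\<close> next to a displaced one.\<close>
  define S where "S = insert \<one> S0"
  have S: "finite S" "S \<subseteq> carrier G" "\<one> \<in> S" using S0 by (auto simp: S_def)
  then have card: "card S > 0" by (auto simp: card_gt_0_iff)
  define q where "q = sqrt (max 0 (1 - \<epsilon>\<^sup>2 / 4))"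
  have "q < sqrt 1" unfolding q_def using \<epsilon> by (intro real_sqrt_less_mono) simp
  then have q: "0 \<le> q" "q < 1" by (auto simp: q_def)
  define r where "r = (real (card S) - 1 + q) / real (card S)"
  define f :: "'a \<Rightarrow> complex" where "f = (\<lambda>g. if g \<in> S then 1 / of_nat (card S) else 0)"
  show ?thesis
  proof
    show "f \<in> carrier CG"
      using S by (intro CG_memI[of S]) (auto simp: f_def split: if_splits)
    show "augmentation f = 1"
      using S card by (subst augmentation_superset[of S]) (auto simp: f_def split: if_splits)
    show "0 \<le> r" "r < 1"
      using q card by (auto simp: r_def)
    fix H :: "('a \<Rightarrow> complex) hilbert" and \<pi> v
    assume rep: "unitary_rep G H \<pi>" and v: "v \<in> orth_complement H (invariant_vectors G H \<pi>)"
    interpret unitary_representation G H \<pi> by (rule unitary_representationI[OF rep])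
    have hn: "hnorm (H\<lparr>hspace := V\<rparr>) = hnorm H" by (simp add: hnorm_def fun_eq_iff)
    show "hnorm H (\<Phi> f v) \<le> r * hnorm H v"
    proof (cases "v = 0")
      case True
      then show ?thesis
        using integrated_scale_arg[OF \<open>f \<in> carrier CG\<close> zero_hspace, of 0] by simp
    next
      case False
      have "\<not> (\<exists>y\<in>V. y \<noteq> 0 \<and> (\<forall>g\<in>carrier G. \<pi> g y = y))"
        using invariant_V_eq_0 by blast
      \<comment> \<open>Kazhdan's condition is instantiated at the restriction to \<open>V\<close>,
        whose norm is that of \<open>H\<close>.\<close>
      then have "\<exists>s\<in>S0. \<not> hnorm H (\<pi> s v - v) < \<epsilon> * hnorm H v"
        using kazhdan[THEN spec, THEN spec, of "H\<lparr>hspace := V\<rparr>" \<pi>] unitary_rep_V v False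
        unfolding hn by auto
      then obtain s where "s \<in> S" "\<epsilon> * hnorm H v \<le> hnorm H (\<pi> s v - v)"
        by (auto simp: S_def not_less)
      then show ?thesis
        unfolding f_def r_def q_def using S V_hspace[OF v] False \<epsilon> by (intro averaging_contraction) auto
    qed
  qed
qed

section \<open>Convolution powers of the averaging element\<close>

primrec conv_power :: "('a \<Rightarrow> complex) \<Rightarrow> nat \<Rightarrow> 'a \<Rightarrow> complex" where
  "conv_power f 0 = point_mass \<one>"
| "conv_power f (Suc n) = conv_power f n \<otimes>\<^bsub>CG\<^esub> f"

lemma conv_power_closed: "f \<in> carrier CG \<Longrightarrow> conv_power f n \<in> carrier CG"
  by (induction n) (auto simp: CG_mult_closed)

text \<open>This is \<open>integrated_mult\<close> for the trivial representation on a
  one-dimensional space, where \<open>\<Phi> k\<close> is multiplication by the augmentation of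
  \<open>k\<close>.\<close>

lemma augmentation_mult:
  assumes f: "f \<in> carrier CG" and h: "h \<in> carrier CG"
  shows "augmentation (f \<otimes>\<^bsub>CG\<^esub> h) = augmentation f * augmentation h"
proof -
  let ?H = "l2_space {\<one>}"
  have mem: "point_mass \<one> \<in> hspace ?H" by (simp add: point_mass_l2)
  interpret unitary_representation G ?H "\<lambda>g x. x"
    by (intro unitary_representationI unitary_trivial_rep hilbert_l2_space)
  have aug: "\<Phi> k x = hscale ?H (augmentation k) x" for k x
    by (simp add: integrated_rep_def augmentation_def scale_sum_left)
  show ?thesis
    using integrated_mult[OF f h mem] point_mass_nonzero[of \<one>] by (simp add: aug)
qed

lemma augmentation_conv_power:
  "f \<in> carrier CG \<Longrightarrow> augmentation f = 1 \<Longrightarrow> augmentation (conv_power f n) = 1"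
  by (induction n) (auto simp: augmentation_mult conv_power_closed augmentation_point_mass)

text \<open>The element factors as the n-th power of \<open>f\<close> times
  \<open>h - augmentation h\<close>. The second factor maps everything into \<open>V\<close> with
  norm at most \<open>2 * full_norm G h\<close>; the first contracts \<open>V\<close> by
  \<open>r ^ n\<close>.\<close>

lemma conv_power_estimate:
  fixes r :: real
  assumes f: "f \<in> carrier CG" and aug: "augmentation f = 1" and r: "0 \<le> r"
    and gap: "\<And>(H :: ('a \<Rightarrow> complex) hilbert) \<pi> v. unitary_rep G H \<pi> \<Longrightarrow>
      v \<in> orth_complement H (invariant_vectors G H \<pi>) \<Longrightarrow>
      hnorm H (integrated_rep H \<pi> f v) \<le> r * hnorm H v"
    and h: "h \<in> carrier CG"
  shows "full_norm G (conv_power f n \<otimes>\<^bsub>CG\<^esub> h - (\<lambda>x. augmentation h * conv_power f n x))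
    \<le> r ^ n * (2 * full_norm G h)"
proof (rule full_norm_le)
  show "0 \<le> r ^ n * (2 * full_norm G h)"
    using r h by (simp add: full_norm_nonneg)
  fix H :: "('a \<Rightarrow> complex) hilbert" and \<pi> x
  assume rep: "unitary_rep G H \<pi>" and x: "x \<in> hspace H"
  interpret unitary_representation G H \<pi> by (rule unitary_representationI[OF rep])
  let ?p = "conv_power f n" and ?c = "augmentation h"
  have p: "?p \<in> carrier CG" by (rule conv_power_closed[OF f])
  have contract: "hnorm H (\<Phi> (conv_power f n) v) \<le> r ^ n * hnorm H v" if "v \<in> V" for n v
    using that
  proof (induction n arbitrary: v)
    case 0
    then show ?case by (simp add: integrated_point_mass rep_one V_hspace)
  next
    case (Suc n)
    have "\<Phi> f v - v \<in> V"
      using integrated_diff_V[OF f V_hspace[OF Suc.prems]] by (simp add: aug)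
    \<comment> \<open>\<open>f\<close> preserves \<open>V\<close>, since
      \<open>\<Phi> f v - v\<close> and \<open>v\<close> both lie there. The powers carry the new
      factor \<open>f\<close> on the right, so the induction hypothesis is applied to
      \<open>\<Phi> f v\<close>.\<close>
    then have fv: "\<Phi> f v \<in> V"
      using subspace_add[OF subspace_V _ Suc.prems, of "\<Phi> f v - v"] by simp
    have "hnorm H (\<Phi> (conv_power f n) (\<Phi> f v)) \<le> r ^ n * hnorm H (\<Phi> f v)"
      by (rule Suc.IH[OF fv])
    also have "\<dots> \<le> r ^ n * (r * hnorm H v)"
      using gap[OF rep Suc.prems] r by (intro mult_left_mono) auto
    finally show ?case
      using f V_hspace[OF Suc.prems] by (simp add: integrated_mult conv_power_closed mult_ac)
  qed
  have "hnorm H (\<Phi> h x - hscale H ?c x) \<le> hnorm H (\<Phi> h x) + hnorm H (hscale H ?c x)"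
    using h x by (intro hnorm_diff_triangle) (auto simp: integrated_closed scale_hspace)
  also have "\<dots> \<le> full_norm G h * hnorm H x + full_norm G h * hnorm H x"
    using hnorm_integrated_le[OF h rep x] x
      mult_right_mono[OF cmod_augmentation_le[OF h] hnorm_nonneg[OF x]]
    by (intro add_mono) (auto simp: hnorm_scale)
  finally have bound: "hnorm H (\<Phi> h x - hscale H ?c x) \<le> 2 * full_norm G h * hnorm H x" by simp
  have eq: "\<Phi> (?p \<otimes>\<^bsub>CG\<^esub> h - (\<lambda>x. ?c * ?p x)) x = \<Phi> ?p (\<Phi> h x - hscale H ?c x)"
    using p h x
    by (simp add: integrated_diff integrated_mult integrated_smult integrated_diff_arg
        integrated_scale_arg CG_mult_closed CG_smult_closed integrated_closed scale_hspace)
  have "hnorm H (\<Phi> ?p (\<Phi> h x - hscale H ?c x)) \<le> r ^ n * hnorm H (\<Phi> h x - hscale H ?c x)"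
    by (rule contract[OF integrated_diff_V[OF h x]])
  also have "\<dots> \<le> r ^ n * (2 * full_norm G h * hnorm H x)"
    using bound r by (intro mult_left_mono) auto
  finally show "hnorm H (\<Phi> (?p \<otimes>\<^bsub>CG\<^esub> h - (\<lambda>x. ?c * ?p x)) x)
      \<le> r ^ n * (2 * full_norm G h) * hnorm H x"
    unfolding eq by (simp only: mult.assoc)
qed

text \<open>Partial sums of a geometric series. Keeping the exact difference
  \<open>r ^ n - r ^ (n + k)\<close> makes the induction on \<open>k\<close> close with
  equality.\<close>

lemma conv_power_tail:
  fixes r :: real
  assumes step: "\<And>n. full_norm G (conv_power f (Suc n) - conv_power f n) \<le> r ^ n * C"
    and f: "f \<in> carrier CG" and r: "0 \<le> r" "r < 1"
  shows "full_norm G (conv_power f (n + k) - conv_power f n) \<le> C / (1 - r) * (r ^ n - r ^ (n + k))"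
proof (induction k)
  case 0
  have "full_norm G (conv_power f n - conv_power f n) = full_norm G (\<lambda>x. 0 * conv_power f n x)"
    by (rule arg_cong[where f="full_norm G"]) (simp add: fun_eq_iff)
  then show ?case using full_norm_smult[OF conv_power_closed[OF f], of 0 n] by simp
next
  case (Suc k)
  have "full_norm G (conv_power f (n + Suc k) - conv_power f n) \<le>
      full_norm G (conv_power f (Suc (n + k)) - conv_power f (n + k)) +
      full_norm G (conv_power f (n + k) - conv_power f n)"
    using full_norm_diff_triangle[of "conv_power f (n + Suc k)" "conv_power f (n + k)" "conv_power f n"]
      conv_power_closed[OF f] by (simp del: conv_power.simps)
  also have "\<dots> \<le> r ^ (n + k) * C + C / (1 - r) * (r ^ n - r ^ (n + k))"
    by (intro add_mono step Suc)
  also have "\<dots> = C / (1 - r) * (r ^ n - r ^ (n + Suc k))"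
    using r by (simp add: field_simps)
  finally show ?case .
qed

end


section \<open>The Kazhdan projection in the completion\<close>

context group
begin

lemma adist_CG: "adist CG f h = full_norm G (f - h)"
  by (simp add: adist_def group_star_algebra_def fun_diff_def)

lemma cauchy_seqs_CG:
  "X \<in> cauchy_seqs CG \<longleftrightarrow> (\<forall>n. X n \<in> carrier CG) \<and>
    (\<forall>e>0. \<exists>N. \<forall>m\<ge>N. \<forall>n\<ge>N. full_norm G (X m - X n) < e)"
  by (simp add: cauchy_seqs_def adist_CG)

lemma cauchy_seqs_closed: "X \<in> cauchy_seqs CG \<Longrightarrow> X n \<in> carrier CG"
  by (simp add: cauchy_seqs_CG)

lemma cauchy_rel_CG:
  "(X, Y) \<in> cauchy_rel CG \<longleftrightarrow> X \<in> cauchy_seqs CG \<and> Y \<in> cauchy_seqs CG \<and>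
    (\<lambda>n. full_norm G (X n - Y n)) \<longlonglongrightarrow> 0"
  by (simp add: cauchy_rel_def adist_CG)

lemma full_norm_zero: "full_norm G 0 = 0"
proof -
  have "full_norm G (\<lambda>x. 0 * point_mass \<one> x) \<le> 0"
    using full_norm_smult[OF point_mass_CG[OF one_closed], of 0] by simp
  moreover have "0 = (\<lambda>x. 0 * point_mass \<one> x)" by (simp add: fun_eq_iff)
  ultimately show ?thesis
    using full_norm_nonneg[OF CG_smult_closed[OF point_mass_CG[OF one_closed]], of 0]
    by (simp only:)
qed

lemma tendsto_0_squeeze:
  fixes a b :: "nat \<Rightarrow> real"
  assumes "\<And>n. 0 \<le> a n" "\<And>n. a n \<le> b n" "b \<longlonglongrightarrow> 0"
  shows "a \<longlonglongrightarrow> 0"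
  by (rule tendsto_sandwich[OF _ _ tendsto_const assms(3)]) (use assms in auto)

lemma equiv_cauchy_rel: "equiv (cauchy_seqs CG) (cauchy_rel CG)"
proof (rule equivI)
  show "cauchy_rel CG \<subseteq> cauchy_seqs CG \<times> cauchy_seqs CG"
    by (auto simp: cauchy_rel_CG)
  show "refl_on (cauchy_seqs CG) (cauchy_rel CG)"
    by (auto simp: refl_on_def cauchy_rel_CG full_norm_zero)
  show "sym (cauchy_rel CG)"
    by (rule symI) (simp add: cauchy_rel_CG full_norm_minus_commute cauchy_seqs_closed)
  show "trans (cauchy_rel CG)"
  proof (rule transI)
    fix X Y Z assume "(X, Y) \<in> cauchy_rel CG" "(Y, Z) \<in> cauchy_rel CG"
    then have seqs: "X \<in> cauchy_seqs CG" "Y \<in> cauchy_seqs CG" "Z \<in> cauchy_seqs CG"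
      and lim: "(\<lambda>n. full_norm G (X n - Y n)) \<longlonglongrightarrow> 0" "(\<lambda>n. full_norm G (Y n - Z n)) \<longlonglongrightarrow> 0"
      by (auto simp: cauchy_rel_CG)
    have "(\<lambda>n. full_norm G (X n - Z n)) \<longlonglongrightarrow> 0"
    proof (rule tendsto_0_squeeze)
      show "0 \<le> full_norm G (X n - Z n)"
        "full_norm G (X n - Z n) \<le> full_norm G (X n - Y n) + full_norm G (Y n - Z n)" for n
        by (intro full_norm_nonneg full_norm_diff_triangle CG_diff_closed
            cauchy_seqs_closed[OF seqs(1)] cauchy_seqs_closed[OF seqs(2)] cauchy_seqs_closed[OF seqs(3)])+
      show "(\<lambda>n. full_norm G (X n - Y n) + full_norm G (Y n - Z n)) \<longlonglongrightarrow> 0"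
        using tendsto_add[OF lim] by simp
    qed
    then show "(X, Z) \<in> cauchy_rel CG"
      using seqs by (simp add: cauchy_rel_CG)
  qed
qed

lemma cauchy_class_eq_iff:
  "X \<in> cauchy_seqs CG \<Longrightarrow> Y \<in> cauchy_seqs CG \<Longrightarrow>
    cauchy_class CG X = cauchy_class CG Y \<longleftrightarrow> (X, Y) \<in> cauchy_rel CG"
  unfolding cauchy_class_def by (rule eq_equiv_class_iff[OF equiv_cauchy_rel])

lemma cauchy_class_closed:
  "X \<in> cauchy_seqs CG \<Longrightarrow> cauchy_class CG X \<in> carrier (completion CG)"
  by (simp add: completion_def cauchy_class_def quotientI)

text \<open>The operations of \<open>completion\<close> are defined through chosen representatives.
  A class contains its own generating sequence, so the choice does return a member, from which the
  class can be recovered.\<close>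

lemma class_rep_completion:
  assumes "P \<in> carrier (completion CG)"
  shows "class_rep P \<in> cauchy_seqs CG" "cauchy_class CG (class_rep P) = P"
proof -
  obtain X where X: "X \<in> cauchy_seqs CG" "P = cauchy_class CG X"
    using assms by (auto simp: completion_def cauchy_class_def elim: quotientE)
  then have "X \<in> P"
    using equiv_class_self[OF equiv_cauchy_rel] by (simp add: cauchy_class_def)
  then have "class_rep P \<in> P"
    unfolding class_rep_def by (rule someI[of "\<lambda>X. X \<in> P"])
  then have rel: "(X, class_rep P) \<in> cauchy_rel CG"
    using X by (simp add: cauchy_class_def)
  then show "class_rep P \<in> cauchy_seqs CG" by (simp add: cauchy_rel_CG)
  then show "cauchy_class CG (class_rep P) = P"
    using rel X by (simp add: cauchy_class_eq_iff[symmetric])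
qed

lemma class_rep_cauchy_class:
  assumes "X \<in> cauchy_seqs CG"
  shows "(class_rep (cauchy_class CG X), X) \<in> cauchy_rel CG"
  using class_rep_completion[OF cauchy_class_closed[OF assms]] assms
  by (simp add: cauchy_class_eq_iff)

text \<open>A sequence asymptotic to a Cauchy sequence is itself Cauchy, by a three-epsilon
  argument. This later spares a separate proof that a product of sequences is Cauchy.\<close>

lemma cauchy_rel_of_tendsto:
  assumes X: "X \<in> cauchy_seqs CG" and Y: "\<And>n. Y n \<in> carrier CG"
    and lim: "(\<lambda>n. full_norm G (X n - Y n)) \<longlonglongrightarrow> 0"
  shows "(X, Y) \<in> cauchy_rel CG"
proof -
  have "\<exists>N. \<forall>m\<ge>N. \<forall>n\<ge>N. full_norm G (Y m - Y n) < e" if e: "e > 0" for e :: real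
  proof -
    have e3: "e / 3 > 0" using e by simp
    obtain N1 where N1: "\<forall>m\<ge>N1. \<forall>n\<ge>N1. full_norm G (X m - X n) < e / 3"
      using X e3 unfolding cauchy_seqs_CG by blast
    obtain N2 where N2: "\<forall>n\<ge>N2. full_norm G (X n - Y n) < e / 3"
      using LIMSEQ_D[OF lim e3] by (metis abs_le_D1 abs_of_nonneg diff_zero real_norm_def
          full_norm_nonneg[OF CG_diff_closed[OF cauchy_seqs_closed[OF X] Y]])
    have "full_norm G (Y m - Y n) < e" if "m \<ge> max N1 N2" "n \<ge> max N1 N2" for m n
    proof -
      note mem = Y[of m] Y[of n] cauchy_seqs_closed[OF X, of m] cauchy_seqs_closed[OF X, of n]
      have "full_norm G (Y m - X m) < e / 3" "full_norm G (X n - Y n) < e / 3"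
        "full_norm G (X m - X n) < e / 3"
        using N1 N2 that mem by (auto simp: full_norm_minus_commute[of "Y m"])
      then show ?thesis
        using full_norm_diff_triangle[OF mem(1,3,2)] full_norm_diff_triangle[OF mem(3,4,2)] by linarith
    qed
    then show ?thesis by blast
  qed
  then show ?thesis
    using X Y lim by (simp add: cauchy_rel_CG cauchy_seqs_CG)
qed

lemma const_cauchy: "f \<in> carrier CG \<Longrightarrow> (\<lambda>n. f) \<in> cauchy_seqs CG"
  by (simp add: cauchy_seqs_CG full_norm_zero)

lemma smult_cauchy:
  assumes X: "X \<in> cauchy_seqs CG"
  shows "(\<lambda>n x. c * X n x) \<in> cauchy_seqs CG"
proof -
  have "\<exists>N. \<forall>m\<ge>N. \<forall>n\<ge>N. full_norm G ((\<lambda>x. c * X m x) - (\<lambda>x. c * X n x)) < e"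
    if e: "e > 0" for e :: real
  proof -
    \<comment> \<open>Adding 1 covers \<open>c = 0\<close>.\<close>
    have "e / (cmod c + 1) > 0" using e by (simp add: add_nonneg_pos)
    then obtain N where N: "\<forall>m\<ge>N. \<forall>n\<ge>N. full_norm G (X m - X n) < e / (cmod c + 1)"
      using X unfolding cauchy_seqs_CG by blast
    have "full_norm G ((\<lambda>x. c * X m x) - (\<lambda>x. c * X n x)) < e" if "m \<ge> N" "n \<ge> N" for m n
    proof -
      have mem: "X m - X n \<in> carrier CG" using X by (simp add: CG_diff_closed cauchy_seqs_closed)
      have "(\<lambda>x. c * X m x) - (\<lambda>x. c * X n x) = (\<lambda>x. c * (X m - X n) x)"
        by (simp add: fun_eq_iff right_diff_distrib)
      then have "full_norm G ((\<lambda>x. c * X m x) - (\<lambda>x. c * X n x)) \<le> cmod c * full_norm G (X m - X n)"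
        using full_norm_smult[OF mem] by simp
      also have "\<dots> \<le> (cmod c + 1) * full_norm G (X m - X n)"
        using full_norm_nonneg[OF mem] by (intro mult_right_mono) auto
      also have "\<dots> < e"
      proof -
        have "full_norm G (X m - X n) < e / (cmod c + 1)" using N that by blast
        then show ?thesis
          by (simp add: pos_less_divide_eq add_nonneg_pos mult.commute)
      qed
      finally show ?thesis .
    qed
    then show ?thesis by blast
  qed
  then show ?thesis using X by (simp add: cauchy_seqs_CG CG_smult_closed)
qed

lemma cauchy_seqs_bounded:
  assumes X: "X \<in> cauchy_seqs CG"
  obtains B where "\<And>n. full_norm G (X n) \<le> B"
proof -
  have "Cauchy (\<lambda>n. full_norm G (X n))"
    unfolding Cauchy_def
  proof (intro allI impI)
    fix e :: real assume "e > 0"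
    then obtain N where N: "\<forall>m\<ge>N. \<forall>n\<ge>N. full_norm G (X m - X n) < e"
      using X unfolding cauchy_seqs_CG by blast
    have le: "full_norm G (X m) \<le> full_norm G (X m - X n) + full_norm G (X n)" for m n
      using full_norm_add[of "X m - X n" "X n"] X by (simp add: CG_diff_closed cauchy_seqs_closed)
    have "dist (full_norm G (X m)) (full_norm G (X n)) < e" if "m \<ge> N" "n \<ge> N" for m n
    proof -
      have "full_norm G (X m - X n) < e" "full_norm G (X n - X m) < e" using N that by auto
      then show ?thesis using le[of m n] le[of n m] by (simp add: dist_real_def abs_less_iff)
    qed
    then show "\<exists>M. \<forall>m\<ge>M. \<forall>n\<ge>M. dist (full_norm G (X m)) (full_norm G (X n)) < e" by blast
  qed
  then have "Bseq (\<lambda>n. full_norm G (X n))" by (rule Cauchy_Bseq)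
  then obtain K where "\<And>n. norm (full_norm G (X n)) \<le> K" unfolding Bseq_def by blast
  then show ?thesis using that[of K] by (metis abs_ge_self order_trans real_norm_def)
qed

text \<open>The augmentation is 1-Lipschitz for the full norm. Its limit along a representative
  stands for the extended character on the completion; \<open>augmentation_tendsto_rel\<close> shows
  that equivalent sequences give the same limit.\<close>

lemma augmentation_convergent:
  assumes X: "X \<in> cauchy_seqs CG"
  obtains c where "(\<lambda>n. augmentation (X n)) \<longlonglongrightarrow> c"
proof -
  have "Cauchy (\<lambda>n. augmentation (X n))"
    unfolding Cauchy_def
  proof (intro allI impI)
    fix e :: real assume "e > 0"
    then obtain N where N: "\<forall>m\<ge>N. \<forall>n\<ge>N. full_norm G (X m - X n) < e"
      using X unfolding cauchy_seqs_CG by blast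
    have "dist (augmentation (X m)) (augmentation (X n)) \<le> full_norm G (X m - X n)" for m n
      using cmod_augmentation_le[of "X m - X n"] X
      by (simp add: dist_norm augmentation_diff CG_diff_closed cauchy_seqs_closed)
    then show "\<exists>M. \<forall>m\<ge>M. \<forall>n\<ge>M. dist (augmentation (X m)) (augmentation (X n)) < e"
      using N le_less_trans by blast
  qed
  then show ?thesis using that by (auto simp: Cauchy_convergent_iff convergent_def)
qed

lemma augmentation_tendsto_rel:
  assumes "(X, Y) \<in> cauchy_rel CG" "(\<lambda>n. augmentation (Y n)) \<longlonglongrightarrow> c"
  shows "(\<lambda>n. augmentation (X n)) \<longlonglongrightarrow> c"
proof -
  have seqs: "X \<in> cauchy_seqs CG" "Y \<in> cauchy_seqs CG"
    and lim: "(\<lambda>n. full_norm G (X n - Y n)) \<longlonglongrightarrow> 0"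
    using assms(1) by (auto simp: cauchy_rel_CG)
  have "(\<lambda>n. augmentation (X n) - augmentation (Y n)) \<longlonglongrightarrow> 0"
  proof (rule tendsto_norm_zero_cancel, rule tendsto_0_squeeze[OF _ _ lim])
    show "norm (augmentation (X n) - augmentation (Y n)) \<le> full_norm G (X n - Y n)" for n
      using seqs cmod_augmentation_le[OF CG_diff_closed]
      by (simp add: augmentation_diff[symmetric] cauchy_seqs_closed)
  qed simp
  from tendsto_add[OF this assms(2)] show ?thesis by simp
qed

section \<open>Multiplication by the limit of the powers\<close>

lemma completion_mult:
  "P \<otimes>\<^bsub>completion CG\<^esub> Q = cauchy_class CG (\<lambda>n. class_rep P n \<otimes>\<^bsub>CG\<^esub> class_rep Q n)"
  by (simp add: completion_def)

lemma completion_smult: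
  "c \<odot>\<^bsub>completion CG\<^esub> P = cauchy_class CG (\<lambda>n x. c * class_rep P n x)"
  by (simp add: completion_def group_star_algebra_def[of G])

lemma CG_diff_mult:
  assumes f: "f \<in> carrier CG" and h: "h \<in> carrier CG"
  shows "(f - h) \<otimes>\<^bsub>CG\<^esub> k = f \<otimes>\<^bsub>CG\<^esub> k - h \<otimes>\<^bsub>CG\<^esub> k"
proof
  fix x
  let ?F = "{g. f g \<noteq> 0} \<union> {g. h g \<noteq> 0}"
  have conv: "(\<Sum>y | u y \<noteq> 0. u y * k (inv y \<otimes> x)) = (\<Sum>y\<in>?F. u y * k (inv y \<otimes> x))"
    if "\<And>y. u y \<noteq> 0 \<Longrightarrow> y \<in> ?F" for u
    using f h that by (intro sum.mono_neutral_left) (auto simp: carrier_CG)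
  show "((f - h) \<otimes>\<^bsub>CG\<^esub> k) x = (f \<otimes>\<^bsub>CG\<^esub> k - h \<otimes>\<^bsub>CG\<^esub> k) x"
  proof (cases "x \<in> carrier G")
    case True
    have "((f - h) \<otimes>\<^bsub>CG\<^esub> k) x = (\<Sum>y\<in>?F. (f - h) y * k (inv y \<otimes> x))"
      unfolding CG_mult if_P[OF True] by (rule conv) auto
    moreover have "(f \<otimes>\<^bsub>CG\<^esub> k) x = (\<Sum>y\<in>?F. f y * k (inv y \<otimes> x))"
      "(h \<otimes>\<^bsub>CG\<^esub> k) x = (\<Sum>y\<in>?F. h y * k (inv y \<otimes> x))"
      unfolding CG_mult if_P[OF True] by (rule conv; auto)+
    ultimately show ?thesis
      by (simp add: left_diff_distrib sum_subtractf)
  qed (simp add: CG_mult)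
qed

text \<open>The product is formed from the chosen representative \<open>Y\<close> of the class of
  \<open>E\<close>, whereas the estimate concerns \<open>E\<close> itself. A chain of four
  differences leads from \<open>Y n \<otimes> X n\<close> through \<open>E n\<close> and back to
  \<open>c * Y n\<close>, each with a bound tending to 0.\<close>

lemma completion_absorbing:
  fixes r :: real
  assumes E: "E \<in> cauchy_seqs CG" and r: "0 \<le> r" "r < 1"
    and est: "\<And>n h. h \<in> carrier CG \<Longrightarrow>
      full_norm G (E n \<otimes>\<^bsub>CG\<^esub> h - (\<lambda>x. augmentation h * E n x)) \<le> r ^ n * (2 * full_norm G h)"
    and a: "a \<in> carrier (completion CG)"
    and lim: "(\<lambda>n. augmentation (class_rep a n)) \<longlonglongrightarrow> c"
  shows "cauchy_class CG E \<otimes>\<^bsub>completion CG\<^esub> a = c \<odot>\<^bsub>completion CG\<^esub> cauchy_class CG E"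
proof -
  define X Y where "X = class_rep a" and "Y = class_rep (cauchy_class CG E)"
  have X: "X \<in> cauchy_seqs CG"
    unfolding X_def by (rule class_rep_completion(1)[OF a])
  have YE: "(Y, E) \<in> cauchy_rel CG"
    unfolding Y_def by (rule class_rep_cauchy_class[OF E])
  then have Y: "Y \<in> cauchy_seqs CG" and YE0: "(\<lambda>n. full_norm G (Y n - E n)) \<longlonglongrightarrow> 0"
    by (auto simp: cauchy_rel_CG)
  note mem = cauchy_seqs_closed[OF X] cauchy_seqs_closed[OF Y] cauchy_seqs_closed[OF E]
  obtain B where B: "\<And>n. full_norm G (X n) \<le> B" using cauchy_seqs_bounded[OF X] by blast
  obtain K where K: "\<And>n. full_norm G (E n) \<le> K" using cauchy_seqs_bounded[OF E] by blast
  let ?\<epsilon> = "\<lambda>n. augmentation (X n)"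
  let ?bound = "\<lambda>n. full_norm G (Y n - E n) * B + r ^ n * (2 * B) + cmod (?\<epsilon> n - c) * K
      + cmod c * full_norm G (Y n - E n)"
  have bound: "full_norm G (Y n \<otimes>\<^bsub>CG\<^esub> X n - (\<lambda>x. c * Y n x)) \<le> ?bound n" for n
  proof -
    let ?t1 = "Y n \<otimes>\<^bsub>CG\<^esub> X n" and ?t2 = "E n \<otimes>\<^bsub>CG\<^esub> X n" and ?t3 = "\<lambda>x. ?\<epsilon> n * E n x"
      and ?t4 = "\<lambda>x. c * E n x" and ?t5 = "\<lambda>x. c * Y n x"
    have t: "?t1 \<in> carrier CG" "?t2 \<in> carrier CG" "?t3 \<in> carrier CG" "?t4 \<in> carrier CG"
      "?t5 \<in> carrier CG"
      using mem by (auto intro: CG_mult_closed CG_smult_closed)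
    have "full_norm G (?t1 - ?t2) \<le> full_norm G (Y n - E n) * full_norm G (X n)"
      using full_norm_mult[of "Y n - E n" "X n"] mem by (simp add: CG_diff_mult CG_diff_closed)
    also have "\<dots> \<le> full_norm G (Y n - E n) * B"
      using B mem by (intro mult_left_mono full_norm_nonneg CG_diff_closed)
    finally have b1: "full_norm G (?t1 - ?t2) \<le> full_norm G (Y n - E n) * B" .
    have "full_norm G (?t2 - ?t3) \<le> r ^ n * (2 * full_norm G (X n))"
      by (rule est[OF mem(1)])
    also have "\<dots> \<le> r ^ n * (2 * B)"
      using B r by (intro mult_left_mono) auto
    finally have b2: "full_norm G (?t2 - ?t3) \<le> r ^ n * (2 * B)" .
    have "?t3 - ?t4 = (\<lambda>x. (?\<epsilon> n - c) * E n x)" by (simp add: fun_eq_iff left_diff_distrib)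
    then have "full_norm G (?t3 - ?t4) \<le> cmod (?\<epsilon> n - c) * full_norm G (E n)"
      using full_norm_smult[OF mem(3)[of n]] by simp
    also have "\<dots> \<le> cmod (?\<epsilon> n - c) * K"
      using K by (intro mult_left_mono) auto
    finally have b3: "full_norm G (?t3 - ?t4) \<le> cmod (?\<epsilon> n - c) * K" .
    have "?t4 - ?t5 = (\<lambda>x. c * (E n - Y n) x)" by (simp add: fun_eq_iff right_diff_distrib)
    then have b4: "full_norm G (?t4 - ?t5) \<le> cmod c * full_norm G (Y n - E n)"
      using full_norm_smult[OF CG_diff_closed[OF mem(3,2)], of c n n] mem
        full_norm_minus_commute[of "E n" "Y n"] by simp
    show ?thesis
      using full_norm_diff_triangle[OF t(1,2,5)] full_norm_diff_triangle[OF t(2,3,5)]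
        full_norm_diff_triangle[OF t(3,4,5)] b1 b2 b3 b4 by linarith
  qed
  have "?bound \<longlonglongrightarrow> 0 * B + 0 * (2 * B) + cmod (c - c) * K + cmod c * 0"
    using lim unfolding X_def[symmetric] by (intro tendsto_intros YE0 LIMSEQ_realpow_zero r)
  then have b0: "?bound \<longlonglongrightarrow> 0" by simp
  \<comment> \<open>The difference is turned around because \<open>cauchy_rel_of_tendsto\<close>
    starts from the sequence already known to be Cauchy, here the scalar multiple.\<close>
  have "(\<lambda>n. full_norm G ((\<lambda>x. c * Y n x) - Y n \<otimes>\<^bsub>CG\<^esub> X n)) \<longlonglongrightarrow> 0"
  proof (rule tendsto_0_squeeze[OF _ _ b0])
    have m: "(\<lambda>x. c * Y n x) \<in> carrier CG" "Y n \<otimes>\<^bsub>CG\<^esub> X n \<in> carrier CG" for n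
      using mem by (auto intro: CG_mult_closed CG_smult_closed)
    show "0 \<le> full_norm G ((\<lambda>x. c * Y n x) - Y n \<otimes>\<^bsub>CG\<^esub> X n)" for n
      by (intro full_norm_nonneg CG_diff_closed m)
    show "full_norm G ((\<lambda>x. c * Y n x) - Y n \<otimes>\<^bsub>CG\<^esub> X n) \<le> ?bound n" for n
      using bound[of n] full_norm_minus_commute[OF m] by simp
  qed
  then have rel: "(\<lambda>n x. c * Y n x, \<lambda>n. Y n \<otimes>\<^bsub>CG\<^esub> X n) \<in> cauchy_rel CG"
    using mem by (intro cauchy_rel_of_tendsto smult_cauchy[OF Y]) (auto intro: CG_mult_closed)
  then show ?thesis
    unfolding completion_mult completion_smult X_def[symmetric] Y_def[symmetric]
    by (metis cauchy_class_eq_iff cauchy_rel_CG)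
qed

text \<open>The Kazhdan projection enters only through its nonvanishing and its absorption law. The
  zero element is written as \<open>0\<close> times \<open>p\<close>, the form on which a
  representation is evaluated directly by homogeneity.\<close>

lemma kazhdan_projection:
  assumes "kazhdan_property_T G"
  obtains p where "p \<in> carrier (completion CG)" "p \<noteq> 0 \<odot>\<^bsub>completion CG\<^esub> p"
    "\<And>a c. a \<in> carrier (completion CG) \<Longrightarrow> (\<lambda>n. augmentation (class_rep a n)) \<longlonglongrightarrow> c \<Longrightarrow>
      p \<otimes>\<^bsub>completion CG\<^esub> a = c \<odot>\<^bsub>completion CG\<^esub> p"
proof -
  obtain f and r :: real where f: "f \<in> carrier CG" and aug: "augmentation f = 1" and r: "0 \<le> r" "r < 1"
    and gap: "\<And>(H :: ('a \<Rightarrow> complex) hilbert) \<pi> v. unitary_rep G H \<pi> \<Longrightarrow>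
      v \<in> orth_complement H (invariant_vectors G H \<pi>) \<Longrightarrow>
      hnorm H (integrated_rep H \<pi> f v) \<le> r * hnorm H v"
    by (rule spectral_gap[OF assms]) blast
  let ?E = "conv_power f"
  have est: "full_norm G (?E n \<otimes>\<^bsub>CG\<^esub> h - (\<lambda>x. augmentation h * ?E n x)) \<le> r ^ n * (2 * full_norm G h)"
    if "h \<in> carrier CG" for n h
    by (rule conv_power_estimate[OF f aug r(1) gap that])
  define C where "C = 2 * full_norm G f / (1 - r)"
  have C: "C \<ge> 0" using r f by (simp add: C_def full_norm_nonneg)
  \<comment> \<open>The estimate at \<open>h = f\<close>, where the augmentation is 1, compares
    consecutive powers.\<close>
  have step: "full_norm G (?E (Suc n) - ?E n) \<le> r ^ n * (2 * full_norm G f)" for n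
    using est[OF f, of n] by (simp add: aug)
  have tail: "full_norm G (?E (n + k) - ?E n) \<le> C * r ^ n" for n k
  proof -
    have "full_norm G (?E (n + k) - ?E n) \<le> C * (r ^ n - r ^ (n + k))"
      unfolding C_def by (rule conv_power_tail[OF step f r])
    also have "\<dots> \<le> C * r ^ n"
      using C r by (intro mult_left_mono) auto
    finally show ?thesis .
  qed
  have E: "?E \<in> cauchy_seqs CG"
    unfolding cauchy_seqs_CG
  proof (intro conjI allI impI)
    show mem: "?E n \<in> carrier CG" for n by (rule conv_power_closed[OF f])
    fix e :: real assume e: "e > 0"
    have "(\<lambda>n. C * r ^ n) \<longlonglongrightarrow> C * 0"
      using r by (intro tendsto_intros LIMSEQ_realpow_zero)
    then have "(\<lambda>n. C * r ^ n) \<longlonglongrightarrow> 0" by simp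
    from LIMSEQ_D[OF this, of "e / 2"] e obtain N where "norm (C * r ^ N - 0) < e / 2"
      by auto
    then have N: "C * r ^ N < e / 2" by simp
    have close: "full_norm G (?E m - ?E N) < e / 2" if "m \<ge> N" for m
      using tail[of N "m - N"] N that by simp
    have "full_norm G (?E m - ?E n) < e" if "m \<ge> N" "n \<ge> N" for m n
      using full_norm_diff_triangle[OF mem mem mem, of m n N] close[OF that(1)] close[OF that(2)]
        full_norm_minus_commute[OF mem mem, of n N] by linarith
    then show "\<exists>N. \<forall>m\<ge>N. \<forall>n\<ge>N. full_norm G (?E m - ?E n) < e" by blast
  qed
  let ?p = "cauchy_class CG ?E"
  have p: "?p \<in> carrier (completion CG)" by (rule cauchy_class_closed[OF E])
  have "?p \<noteq> 0 \<odot>\<^bsub>completion CG\<^esub> ?p"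
  proof
    assume "?p = 0 \<odot>\<^bsub>completion CG\<^esub> ?p"
    then have "cauchy_class CG ?E = cauchy_class CG (\<lambda>n x. 0 * class_rep ?p n x)"
      by (simp only: completion_smult)
    then have "(?E, \<lambda>n x. 0 * class_rep ?p n x) \<in> cauchy_rel CG"
      using E smult_cauchy[OF class_rep_completion(1)[OF p]] cauchy_class_eq_iff by blast
    then have "(\<lambda>n. full_norm G (?E n - (\<lambda>x. 0 * class_rep ?p n x))) \<longlonglongrightarrow> 0"
      by (simp only: cauchy_rel_CG)
    moreover have "?E n - (\<lambda>x. 0 * class_rep ?p n x) = ?E n" for n
      by (simp add: fun_eq_iff)
    ultimately have "(\<lambda>n. full_norm G (?E n)) \<longlonglongrightarrow> 0" by simp
    \<comment> \<open>Every power has augmentation 1, which keeps the norms away from 0.\<close>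
    moreover have "1 \<le> full_norm G (?E n)" for n
      using cmod_augmentation_le[OF conv_power_closed[OF f], of n]
      by (simp add: augmentation_conv_power[OF f aug])
    ultimately have "(1::real) \<le> 0" by (intro LIMSEQ_le_const) auto
    then show False by simp
  qed
  then show ?thesis
    using that[OF p] completion_absorbing[OF E r est] by blast
qed

end


section \<open>Primitivity\<close>

theorem proposition3:
  fixes G :: "('g, 'm) monoid_scheme"
  assumes "group G"
    and "countable (carrier G)"
    and "kazhdan_property_T G"
    and "primitive TYPE('h::ab_group_add) (full_group_cstar_algebra G)"
  shows "carrier G = {\<one>\<^bsub>G\<^esub>}"
proof -
  interpret group G by (rule assms(1))
  let ?A = "completion CG"
  obtain H :: "'h hilbert" and \<phi> where rep: "star_rep ?A H \<phi>"
    and irred: "irreducible_rep ?A H \<phi>" and faithful: "faithful_rep ?A H \<phi>"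
    using assms(4) unfolding primitive_def full_group_cstar_algebra_def by blast
  obtain p where p: "p \<in> carrier ?A" and p0: "p \<noteq> 0 \<odot>\<^bsub>?A\<^esub> p"
    and absorb: "\<And>a c. a \<in> carrier ?A \<Longrightarrow> (\<lambda>n. augmentation (class_rep a n)) \<longlonglongrightarrow> c \<Longrightarrow>
      p \<otimes>\<^bsub>?A\<^esub> a = c \<odot>\<^bsub>?A\<^esub> p"
    using kazhdan_projection[OF assms(3)] by blast
  interpret complex_hilbert_space H using rep by (simp add: star_rep_def)
  have bounded: "bounded_operator H (\<phi> a)" if "a \<in> carrier ?A" for a
    using rep that by (simp add: star_rep_def)
  have smult: "\<phi> (c \<odot>\<^bsub>?A\<^esub> a) x = hscale H c (\<phi> a x)" if "a \<in> carrier ?A" "x \<in> hspace H" for c a x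
    using rep that by (simp add: star_rep_def)
  have mult: "\<phi> (a \<otimes>\<^bsub>?A\<^esub> b) x = \<phi> a (\<phi> b x)"
    if "a \<in> carrier ?A" "b \<in> carrier ?A" "x \<in> hspace H" for a b x
    using rep that by (simp add: star_rep_def)
  have closed: "\<phi> a x \<in> hspace H" if "a \<in> carrier ?A" "x \<in> hspace H" for a x
    using bounded[OF that(1)] that(2) by (simp add: bounded_operator_def linear_operator_def)
  have pH: "\<phi> p x \<in> hspace H" if "x \<in> hspace H" for x by (rule closed[OF p that])
  have add: "\<phi> p (x + y) = \<phi> p x + \<phi> p y" and scale: "\<phi> p (hscale H c x) = hscale H c (\<phi> p x)"
    if "x \<in> hspace H" "y \<in> hspace H" for x y c
    using bounded[OF p] that by (auto simp: bounded_operator_def linear_operator_def)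
  have diff: "\<phi> p (x - y) = \<phi> p x - \<phi> p y" if "x \<in> hspace H" "y \<in> hspace H" for x y
    using add[of "x - y" y] that by (simp add: diff_hspace)
  \<comment> \<open>The absorption law seen in the representation: behind \<open>\<phi> p\<close>,
    every \<open>a\<close> acts as a scalar.\<close>
  have twist: "\<phi> p (\<phi> a x) = hscale H c (\<phi> p x)"
    if "a \<in> carrier ?A" "x \<in> hspace H" "(\<lambda>n. augmentation (class_rep a n)) \<longlonglongrightarrow> c" for a x c
    using mult[OF p that(1,2)] absorb[OF that(1,3)] smult[OF p that(2)] by simp

  \<comment> \<open>The kernel of \<open>\<phi> p\<close> is closed because \<open>\<phi> p\<close>
    is bounded, and invariant by \<open>twist\<close>.\<close>
  define W where "W = {x \<in> hspace H. \<phi> p x = 0}"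
  have "closed_hsubspace H W"
    unfolding closed_hsubspace_def
  proof (intro conjI allI ballI impI)
    show "W \<subseteq> hspace H" by (auto simp: W_def)
    show "subspace W"
      using add scale scale[of 0 0 0] by (auto intro!: subspaceI simp: W_def hspace_intros)
    fix X x assume x: "x \<in> hspace H" and X: "(\<forall>n. X n \<in> W) \<and> (\<lambda>n. hnorm H (X n - x)) \<longlonglongrightarrow> 0"
    obtain K where K: "\<And>y. y \<in> hspace H \<Longrightarrow> hnorm H (\<phi> p y) \<le> K * hnorm H y"
      using bounded[OF p] by (auto simp: bounded_operator_def)
    have "hnorm H (\<phi> p x) \<le> K * hnorm H (X n - x)" for n
    proof -
      have Xn: "X n \<in> hspace H" "\<phi> p (X n) = 0" using X by (auto simp: W_def)
      then show ?thesis
        using K[of "X n - x"] x hnorm_uminus[OF pH[OF x]] by (simp add: diff diff_hspace)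
    qed
    moreover have "(\<lambda>n. K * hnorm H (X n - x)) \<longlonglongrightarrow> 0"
      using tendsto_mult_left[of _ 0 sequentially K] X by force
    ultimately have "hnorm H (\<phi> p x) \<le> 0" by (intro LIMSEQ_le_const) auto
    then show "x \<in> W"
      using hnorm_pos[OF pH[OF x]] x by (force simp: W_def)
  qed
  moreover have "\<phi> a w \<in> W" if a: "a \<in> carrier ?A" and w: "w \<in> W" for a w
  proof -
    obtain c where "(\<lambda>n. augmentation (class_rep a n)) \<longlonglongrightarrow> c"
      using augmentation_convergent[OF class_rep_completion(1)[OF a]] .
    then show ?thesis
      using twist[OF a] w closed[OF a] by (simp add: W_def)
  qed
  ultimately have "W = {0} \<or> W = hspace H"
    using irred unfolding irreducible_rep_def by blast
  \<comment> \<open>Otherwise \<open>p\<close> and its zero multiple would act alike, against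
    faithfulness.\<close>
  moreover have "W \<noteq> hspace H"
  proof
    assume "W = hspace H"
    then have "\<phi> p x = \<phi> (0 \<odot>\<^bsub>?A\<^esub> p) x" if "x \<in> hspace H" for x
      using that smult[OF p that, of 0] by (auto simp: W_def)
    moreover have "0 \<odot>\<^bsub>?A\<^esub> p \<in> carrier ?A"
      unfolding completion_smult by (intro cauchy_class_closed smult_cauchy class_rep_completion p)
    ultimately show False
      using faithful p p0 unfolding faithful_rep_def by blast
  qed
  ultimately have W: "W = {0}" by blast
  \<comment> \<open>The augmentation of a point mass is 1, so \<open>twist\<close> puts the
    displacement of \<open>x\<close> into the kernel \<open>W\<close>, which is zero.\<close>
  have trivial: "\<phi> (cauchy_class CG (\<lambda>n. point_mass g)) x = x" if g: "g \<in> carrier G" and x: "x \<in> hspace H" for g x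
  proof -
    let ?X = "\<lambda>n. point_mass g"
    have X: "?X \<in> cauchy_seqs CG" by (intro const_cauchy point_mass_CG g)
    note a = cauchy_class_closed[OF X]
    have "(\<lambda>n. augmentation (class_rep (cauchy_class CG ?X) n)) \<longlonglongrightarrow> 1"
      by (rule augmentation_tendsto_rel[OF class_rep_cauchy_class[OF X]])
        (simp add: augmentation_point_mass)
    then have "\<phi> p (\<phi> (cauchy_class CG ?X) x - x) = 0"
      using twist[OF a x] x closed[OF a x] by (simp add: diff)
    then have "\<phi> (cauchy_class CG ?X) x - x \<in> W"
      using closed[OF a x] x by (simp add: W_def diff_hspace)
    then show ?thesis using W by simp
  qed
  have "g = \<one>\<^bsub>G\<^esub>" if g: "g \<in> carrier G" for g
  proof -
    have seqs: "(\<lambda>n. point_mass g) \<in> cauchy_seqs CG" "(\<lambda>n. point_mass \<one>\<^bsub>G\<^esub>) \<in> cauchy_seqs CG"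
      using g by (auto intro: const_cauchy)
    \<comment> \<open>Both classes act as the identity operator, so faithfulness identifies them. As
      the sequences are constant, their distance in the full norm is then exactly 0.\<close>
    have "cauchy_class CG (\<lambda>n. point_mass g) = cauchy_class CG (\<lambda>n. point_mass \<one>\<^bsub>G\<^esub>)"
      using faithful cauchy_class_closed seqs trivial g one_closed unfolding faithful_rep_def by metis
    then have "(\<lambda>n. point_mass g, \<lambda>n. point_mass \<one>\<^bsub>G\<^esub>) \<in> cauchy_rel CG"
      using cauchy_class_eq_iff seqs by blast
    then have "full_norm G (point_mass g - point_mass \<one>\<^bsub>G\<^esub>) = 0"
      by (simp add: cauchy_rel_CG LIMSEQ_const_iff)
    then show ?thesis using full_norm_point_mass_diff[OF g] by simp
  qed
  then show ?thesis by auto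
qed

end
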